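(* Let $\mathcal{P}$ be a tight chiral polyhedron of type $\{p, q\}$ with $q$ odd, and let $\Gamma^+(\mathcal{P})=\langle\sigma_1,\sigma_2\rangle$ be its rotation group with its distinguished generators. Then $p$ is an even divisor of $2q$. Furthermore, if the subgroup $\langle \sigma_2 \rangle$ is core-free in $\Gamma^+(\mathcal{P})$, then $p = 2q$.
   Context: An (abstract) polyhedron is a partially ordered set whose elements have rank $0$ (vertices), $1$ (edges) or $2$ (faces), where two elements are incident if they are comparable, such that: every edge is incident to exactly two vertices and two faces; whenever a vertex is incident to a face there are exactly two edges incident to both; the incidence graph is connected; and for every vertex or face $F$, the subgraph of the incidence graph induced on the neighbours of $F$ is connected. A flag is a mutually incident triple (vertex, edge, face); $\Phi^i$ denotes the unique flag differing from $\Phi$ exactly in its rank-$i$ element. Type $\{p,q\}$: every face is incident to $p$ edges and every vertex to $q$ edges. The polyhedron is chiral if its flags split into two classes such that $\Phi$ and $\Phi^i$ always lie in different classes and the automorphism group is transitive on each class but not on all flags. For a chiral polyhedron with fixed base flag $\Phi$, $\sigma_1$ is the automorphism sending $\Phi$ to $(\Phi^1)^0$ and $\sigma_2$ the automorphism sending $\Phi$ to $(\Phi^2)^1$; the rotation group is $\Gamma^+(\mathcal{P})=\langle\sigma_1,\sigma_2\rangle$ (which for chiral $\mathcal P$ is the whole automorphism group). A polyhedron of type $\{p,q\}$ is tight if it has exactly $2pq$ flags. A subgroup $H$ of a group $G$ is core-free if the largest subgroup of $H$ normal in $G$ is trivial. *)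

theory Defs
  imports "HOL-Algebra.Bij" "HOL-Algebra.Generated_Groups" "HOL-Library.Disjoint_Sets"
begin

record 'a ranked_poset =
  elems :: "'a set"
  ord :: "'a rel"
  rk :: "'a \<Rightarrow> nat"

definition elems_of_rank :: "'a ranked_poset \<Rightarrow> nat \<Rightarrow> 'a set" where
  "elems_of_rank P i = {x \<in> elems P. rk P x = i}"

abbreviation vertices :: "'a ranked_poset \<Rightarrow> 'a set" where
  "vertices P \<equiv> elems_of_rank P 0"

abbreviation edges :: "'a ranked_poset \<Rightarrow> 'a set" where
  "edges P \<equiv> elems_of_rank P 1"

abbreviation faces :: "'a ranked_poset \<Rightarrow> 'a set" where
  "faces P \<equiv> elems_of_rank P 2"

definition incident :: "'a ranked_poset \<Rightarrow> 'a \<Rightarrow> 'a \<Rightarrow> bool" where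
  "incident P x y \<longleftrightarrow> (x, y) \<in> ord P \<or> (y, x) \<in> ord P"

text \<open>Connectedness of the subgraph of the incidence graph induced on \<open>S\<close>. An element counts as
  incident to itself; such loops do not affect connectedness.\<close>

definition incidence_connected :: "'a ranked_poset \<Rightarrow> 'a set \<Rightarrow> bool" where
  "incidence_connected P S \<longleftrightarrow>
     (\<forall>x\<in>S. \<forall>y\<in>S. (x, y) \<in> {(a, b). a \<in> S \<and> b \<in> S \<and> incident P a b}\<^sup>*)"

definition neighbours :: "'a ranked_poset \<Rightarrow> 'a \<Rightarrow> 'a set" where
  "neighbours P x = {y \<in> elems P. y \<noteq> x \<and> incident P x y}"

locale polyhedron =
  fixes P :: "'a ranked_poset"
  assumes partial_order: "partial_order_on (elems P) (ord P)"
    and rank_strict_mono: "\<lbrakk>(x, y) \<in> ord P; x \<noteq> y\<rbrakk> \<Longrightarrow> rk P x < rk P y"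
    and rank_range: "x \<in> elems P \<Longrightarrow> rk P x \<in> {0, 1, 2}"
    and edge_vertices: "e \<in> edges P \<Longrightarrow> card {v \<in> vertices P. incident P v e} = 2"
    and edge_faces: "e \<in> edges P \<Longrightarrow> card {f \<in> faces P. incident P e f} = 2"
    and diamond: "\<lbrakk>v \<in> vertices P; f \<in> faces P; incident P v f\<rbrakk> \<Longrightarrow>
      card {e \<in> edges P. incident P v e \<and> incident P e f} = 2"
    and connected: "incidence_connected P (elems P)"
    and locally_connected: "x \<in> vertices P \<union> faces P \<Longrightarrow> incidence_connected P (neighbours P x)"

type_synonym 'a flag = "'a \<times> 'a \<times> 'a"

definition flags :: "'a ranked_poset \<Rightarrow> 'a flag set" where
  "flags P = {(v, e, f). v \<in> vertices P \<and> e \<in> edges P \<and> f \<in> faces P \<and>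
     incident P v e \<and> incident P e f \<and> incident P v f}"

fun flag_elem :: "nat \<Rightarrow> 'a flag \<Rightarrow> 'a" where
  "flag_elem i (v, e, f) = (if i = 0 then v else if i = 1 then e else f)"

definition adj_flag :: "'a ranked_poset \<Rightarrow> nat \<Rightarrow> 'a flag \<Rightarrow> 'a flag" where
  "adj_flag P i \<Phi> =
     (THE \<Psi>. \<Psi> \<in> flags P \<and> (\<forall>j\<le>2. flag_elem j \<Psi> \<noteq> flag_elem j \<Phi> \<longleftrightarrow> j = i))"

definition flag_map :: "('a \<Rightarrow> 'a) \<Rightarrow> 'a flag \<Rightarrow> 'a flag" where
  "flag_map h = map_prod h (map_prod h h)"

definition aut_group :: "'a ranked_poset \<Rightarrow> ('a \<Rightarrow> 'a) monoid" where
  "aut_group P = (BijGroup (elems P))\<lparr>carrier :=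
     {h \<in> Bij (elems P).
        (\<forall>x\<in>elems P. \<forall>y\<in>elems P. (h x, h y) \<in> ord P \<longleftrightarrow> (x, y) \<in> ord P) \<and>
        (\<forall>x\<in>elems P. rk P (h x) = rk P x)}\<rparr>"

definition transitive_on_flags :: "'a ranked_poset \<Rightarrow> 'a flag set \<Rightarrow> bool" where
  "transitive_on_flags P A \<longleftrightarrow>
     (\<forall>\<Phi>\<in>A. \<forall>\<Psi>\<in>A. \<exists>h\<in>carrier (aut_group P). flag_map h \<Phi> = \<Psi>)"

definition chiral :: "'a ranked_poset \<Rightarrow> bool" where
  "chiral P \<longleftrightarrow>
     (\<exists>A B. A \<noteq> B \<and> partition_on (flags P) {A, B} \<and>
        (\<forall>\<Phi>\<in>flags P. \<forall>i\<le>2. \<Phi> \<in> A \<longleftrightarrow> adj_flag P i \<Phi> \<in> B) \<and>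
        transitive_on_flags P A \<and> transitive_on_flags P B) \<and>
     \<not> transitive_on_flags P (flags P)"

text \<open>Finiteness is explicit because infinite sets have cardinality \<open>0\<close>.\<close>

definition has_type :: "'a ranked_poset \<Rightarrow> nat \<Rightarrow> nat \<Rightarrow> bool" where
  "has_type P p q \<longleftrightarrow>
     (\<forall>f\<in>faces P. finite {e \<in> edges P. incident P e f} \<and> card {e \<in> edges P. incident P e f} = p) \<and>
     (\<forall>v\<in>vertices P. finite {e \<in> edges P. incident P v e} \<and> card {e \<in> edges P. incident P v e} = q)"

definition tight :: "'a ranked_poset \<Rightarrow> nat \<Rightarrow> nat \<Rightarrow> bool" where
  "tight P p q \<longleftrightarrow> has_type P p q \<and> finite (flags P) \<and> card (flags P) = 2 * p * q"

definition sigma1 :: "'a ranked_poset \<Rightarrow> 'a flag \<Rightarrow> 'a \<Rightarrow> 'a" where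
  "sigma1 P \<Phi> = (THE h. h \<in> carrier (aut_group P) \<and> flag_map h \<Phi> = adj_flag P 0 (adj_flag P 1 \<Phi>))"

definition sigma2 :: "'a ranked_poset \<Rightarrow> 'a flag \<Rightarrow> 'a \<Rightarrow> 'a" where
  "sigma2 P \<Phi> = (THE h. h \<in> carrier (aut_group P) \<and> flag_map h \<Phi> = adj_flag P 1 (adj_flag P 2 \<Phi>))"

definition rotation_group :: "'a ranked_poset \<Rightarrow> 'a flag \<Rightarrow> ('a \<Rightarrow> 'a) monoid" where
  "rotation_group P \<Phi> = subgroup_generated (aut_group P) {sigma1 P \<Phi>, sigma2 P \<Phi>}"

definition is_core :: "('g, 'm) monoid_scheme \<Rightarrow> 'g set \<Rightarrow> 'g set \<Rightarrow> bool" where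
  "is_core G H K \<longleftrightarrow> K \<lhd> G \<and> K \<subseteq> H \<and> (\<forall>N. N \<lhd> G \<and> N \<subseteq> H \<longrightarrow> N \<subseteq> K)"

definition core_free :: "('g, 'm) monoid_scheme \<Rightarrow> 'g set \<Rightarrow> bool" where
  "core_free G H \<longleftrightarrow> subgroup H G \<and> is_core G H {\<one>\<^bsub>G\<^esub>}"

end

theory Submission
  imports Defs "HOL-Algebra.Multiplicative_Group"
begin

text \<open>
  By tightness and chirality the automorphism group is the exact product \<open>\<langle>\<sigma>\<^sub>1\<rangle>\<langle>\<sigma>\<^sub>2\<rangle>\<close> of cyclic groups of
  orders \<open>p\<close> and \<open>q\<close>, and it contains the involution \<open>\<sigma>\<^sub>1\<sigma>\<^sub>2\<close>; hence \<open>p\<close> is even. Write \<open>a = \<sigma>\<^sub>1\<close>, \<open>b = \<sigma>\<^sub>2\<close>.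
  A power of \<open>a\<close> that \<open>b\<close> conjugates to a power of \<open>a\<close> is central, because \<open>b\<close> acts on it like the
  involution \<open>a b\<close> but has odd order. The central powers of \<open>a\<close> have index less than \<open>q\<close> in \<open>\<langle>a\<rangle>\<close>, so by
  the pigeonhole principle \<open>a x a\<^sup>-\<^sup>1 = k y\<close> for some \<open>x \<noteq> 1\<close>, \<open>y\<close> in \<open>\<langle>b\<rangle>\<close> and a central \<open>k\<close> in \<open>\<langle>a\<rangle>\<close>. Then
  \<open>\<langle>k\<rangle>\<langle>x\<rangle>\<close> is normal and the order of \<open>k\<close> divides that of \<open>x\<close>. Passing to quotients repeatedly until \<open>b\<close>
  becomes trivial gives \<open>p dvd 2 * q\<close>. If \<open>\<langle>b\<rangle>\<close> is core-free, the conjugates of \<open>\<langle>b\<rangle>\<close> by \<open>1\<close> and \<open>a\<close>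
  intersect trivially, so \<open>q < p\<close> and therefore \<open>p = 2 * q\<close>.
\<close>

section \<open>Products of two cyclic groups\<close>

lemma (in group) conj_int_pow:
  assumes "g \<in> carrier G" "x \<in> carrier G"
  shows "g \<otimes> x [^] (i::int) \<otimes> inv g = (g \<otimes> x \<otimes> inv g) [^] i"
proof -
  have "(\<lambda>y. g \<otimes> y \<otimes> inv g) \<in> hom G G"
    using assms by (auto simp: hom_def m_assoc inv_solve_left)
  from hom_int_pow[OF this assms(2) is_group is_group] show ?thesis .
qed

lemma (in group) commute_int_pow:
  assumes "x \<in> carrier G" "y \<in> carrier G" "x \<otimes> y = y \<otimes> x"
  shows "x [^] (i::int) \<otimes> y = y \<otimes> x [^] i"
proof -
  have "y \<otimes> x \<otimes> inv y = x"
    using assms by (metis inv_solve_right m_closed)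
  then have "y \<otimes> x [^] i \<otimes> inv y = x [^] i"
    using conj_int_pow[of y x i] assms by simp
  then show ?thesis
    using assms by (metis inv_solve_right int_pow_closed m_closed)
qed

text \<open>Bezout's identity turns membership in a subgroup of a cyclic group into divisibility.
  The numbers \<open>p'\<close> and \<open>q'\<close> of \<open>admissible\<close> are gcds of this
  kind.\<close>

lemma (in group) int_pow_mem_powers_iff:
  assumes "x \<in> carrier G"
  shows "(\<exists>t::int. x [^] (n::int) = (x [^] (u::int)) [^] t) \<longleftrightarrow> gcd u (int (ord x)) dvd n"
proof
  assume "\<exists>t::int. x [^] n = (x [^] u) [^] t"
  then obtain t where "int (ord x) dvd u * t - n"
    using assms by (auto simp: int_pow_pow int_pow_eq)
  then have "gcd u (int (ord x)) dvd u * t - n" "gcd u (int (ord x)) dvd u * t"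
    by (auto intro: dvd_trans)
  then show "gcd u (int (ord x)) dvd n"
    by (metis dvd_diff_right_iff)
next
  assume "gcd u (int (ord x)) dvd n"
  then obtain c where c: "n = gcd u (int (ord x)) * c" ..
  obtain s v where "s * u + v * int (ord x) = gcd u (int (ord x))"
    using bezout_int by blast
  with c have "n = (s * u + v * int (ord x)) * c" by simp
  then have "u * (s * c) - n = int (ord x) * (- (v * c))"
    by (simp add: algebra_simps)
  then have "x [^] n = (x [^] u) [^] (s * c)"
    using assms by (simp add: int_pow_pow int_pow_eq)
  then show "\<exists>t::int. x [^] n = (x [^] u) [^] t" ..
qed

text \<open>Dividing \<open>u\<close> and \<open>ord x\<close> by their gcd leaves coprime numbers,
  so \<open>ord x dvd u * n\<close> reduces to \<open>k dvd n\<close>. The product form avoids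
  division.\<close>

lemma (in group) ord_int_pow:
  assumes "x \<in> carrier G" "ord x > 0"
  shows "int (ord (x [^] (u::int))) * gcd u (int (ord x)) = int (ord x)"
proof -
  define d where "d = gcd u (int (ord x))"
  have "d > 0" using assms by (simp add: d_def)
  obtain u' k where uk: "u = u' * d" "int (ord x) = k * d" "coprime u' k"
    using gcd_coprime_exists[of u "int (ord x)"] \<open>d > 0\<close> unfolding d_def by (metis less_irrefl)
  have "k > 0" using uk(2) assms(2) \<open>d > 0\<close> by (metis of_nat_0_less_iff zero_less_mult_pos2)
  have "ord (x [^] u) = nat k"
    unfolding ord_unique[OF int_pow_closed[OF assms(1)]]
  proof
    fix n :: nat
    have "(x [^] u) [^] n = x [^] (u * int n)"
      using int_pow_pow[OF assms(1), of u "int n"] by (simp add: int_pow_int)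
    then have "(x [^] u) [^] n = \<one> \<longleftrightarrow> int (ord x) dvd u * int n"
      using assms by (simp add: int_pow_eq_id)
    also have "\<dots> \<longleftrightarrow> k dvd u' * int n"
      using \<open>d > 0\<close> by (simp add: uk mult.commute mult.left_commute)
    also have "\<dots> \<longleftrightarrow> nat k dvd n"
      using uk(3) \<open>k > 0\<close>
      by (simp add: coprime_commute coprime_dvd_mult_right_iff nat_dvd_iff)
    finally show "(x [^] u) [^] n = \<one> \<longleftrightarrow> nat k dvd n" .
  qed
  then show ?thesis using uk(2) \<open>k > 0\<close> by (simp add: d_def)
qed

text \<open>The assumptions are chosen to survive in quotients by admissible subgroups. In
  particular \<open>involution\<close> allows \<open>a b\<close> to become trivial.\<close>

locale cyclic_factorization = group G for G (structure) +
  fixes a b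
  assumes finite_carrier: "finite (carrier G)"
    and a_closed [simp, intro]: "a \<in> carrier G"
    and b_closed [simp, intro]: "b \<in> carrier G"
    and factorization: "x \<in> carrier G \<Longrightarrow> \<exists>(i::int) (j::int). x = a [^] i \<otimes> b [^] j"
    and powers_disjoint: "a [^] (i::int) = b [^] (j::int) \<Longrightarrow> a [^] i = \<one>"
    and involution: "(a \<otimes> b) \<otimes> (a \<otimes> b) = \<one>"
    and odd_ord: "odd (ord b)"
begin

lemma ord_pos: "x \<in> carrier G \<Longrightarrow> ord x > 0"
  using ord_ge_1[OF finite_carrier, of x] by simp

text \<open>Inverting a factorization of \<open>inv x\<close> reverses the order of the two
  factors.\<close>

lemma factorization':
  assumes "x \<in> carrier G"
  obtains i j :: int where "x = b [^] i \<otimes> a [^] j"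
proof -
  obtain i j :: int where "inv x = a [^] i \<otimes> b [^] j"
    using factorization assms by blast
  then have "x = b [^] (-j) \<otimes> a [^] (-i)"
    using assms by (metis a_closed b_closed int_pow_closed int_pow_neg inv_inv inv_mult_group)
  then show thesis by (rule that)
qed

lemma powers_product_eq_one:
  assumes "a [^] (i::int) \<otimes> b [^] (j::int) = \<one>"
  shows "a [^] i = \<one>" "b [^] j = \<one>"
proof -
  have "a [^] i = b [^] (-j)"
    using assms by (simp add: int_pow_neg inv_equality)
  then show "a [^] i = \<one>" by (rule powers_disjoint)
  then show "b [^] j = \<one>" using assms by simp
qed

text \<open>On powers of \<open>a\<close>, conjugation by \<open>b\<close> agrees with conjugation by the involution \<open>a b\<close>;
  hence \<open>b\<^sup>2\<close>, and therefore \<open>b\<close> (having odd order), acts trivially.\<close>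

lemma conj_power_commutes:
  assumes "inv b \<otimes> a [^] (i::int) \<otimes> b = a [^] (j::int)"
  shows "a [^] i \<otimes> b = b \<otimes> a [^] i"
proof -
  let ?c = "a [^] i" and ?d = "a [^] j"
  have cb: "?c \<otimes> b = b \<otimes> ?d"
    using assms by (metis a_closed b_closed int_pow_closed inv_closed inv_solve_left m_assoc m_closed)
  have ac: "a [^] k \<otimes> a = a \<otimes> a [^] k" for k :: int
    by (rule commute_int_pow) auto
  \<comment> \<open>As \<open>a\<close> commutes with \<open>?c\<close>, the relation for
    \<open>b\<close> extends to \<open>a b\<close>. Being an involution, \<open>a b\<close> then
    exchanges \<open>?c\<close> and \<open>?d\<close> under conjugation.\<close>
  have ctau: "?c \<otimes> (a \<otimes> b) = (a \<otimes> b) \<otimes> ?d"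
    by (metis a_closed ac b_closed cb int_pow_closed m_assoc)
  have "(a \<otimes> b) \<otimes> ?c = (a \<otimes> b) \<otimes> ?c \<otimes> ((a \<otimes> b) \<otimes> (a \<otimes> b))"
    by (simp add: involution)
  also have "\<dots> = (a \<otimes> b) \<otimes> (a \<otimes> b) \<otimes> ?d \<otimes> (a \<otimes> b)"
    by (metis a_closed b_closed ctau int_pow_closed m_assoc m_closed)
  also have "\<dots> = ?d \<otimes> (a \<otimes> b)"
    by (simp add: involution)
  finally have dtau: "(a \<otimes> b) \<otimes> ?c = ?d \<otimes> (a \<otimes> b)" .
  \<comment> \<open>Cancelling \<open>a\<close> shows that \<open>b\<close> exchanges
    \<open>?c\<close> and \<open>?d\<close> too, so \<open>b^2\<close> centralizes
    \<open>?c\<close>.\<close>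
  have db: "?d \<otimes> b = b \<otimes> ?c"
  proof -
    have "a \<otimes> (?d \<otimes> b) = a \<otimes> (b \<otimes> ?c)"
      using dtau ac[of j] by (metis a_closed b_closed int_pow_closed m_assoc)
    then show ?thesis by simp
  qed
  have "(b \<otimes> b) \<otimes> ?c = ?c \<otimes> (b \<otimes> b)"
    by (metis b_closed a_closed cb db int_pow_closed m_assoc)
  then have comm: "(b [^] (2::int)) \<otimes> ?c = ?c \<otimes> (b [^] (2::int))"
    using int_pow_mult[of b 1 1] by simp
  obtain k where k: "ord b = 2 * k + 1" using odd_ord by (rule oddE)
  \<comment> \<open>An element of odd order \<open>2 * k + 1\<close> is a power of its own
    square.\<close>
  have "b = (b [^] (2::int)) [^] (int k + 1)"
  proof -
    have "b [^] (1::int) = b [^] (2 * (int k + 1))"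
      by (subst int_pow_eq) (auto simp: k)
    then show ?thesis by (simp add: int_pow_pow)
  qed
  then show ?thesis
    using commute_int_pow[OF _ _ comm, of "int k + 1"] by simp
qed

text \<open>The number of left cosets \<open>c\<langle>a\<rangle>\<close> other than \<open>\<langle>a\<rangle>\<close> is \<open>ord b - 1\<close>, and two powers of \<open>a\<close> taking
  \<open>b\<langle>a\<rangle>\<close> to the same coset differ by a central element.\<close>

lemma central_power:
  assumes "b \<noteq> \<one>"
  obtains m :: nat where "0 < m" "m < ord b" "a [^] int m \<otimes> b = b \<otimes> a [^] int m"
proof -
  define q where "q = int (ord b)"
  have q: "q > 0" using ord_pos[OF b_closed] by (simp add: q_def)
  define m where "m = (LEAST m. 0 < m \<and> a [^] int m \<otimes> b = b \<otimes> a [^] int m)"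
  \<comment> \<open>\<open>ord a\<close> meets the condition, so the least such exponent
    exists.\<close>
  have "0 < ord a \<and> a [^] int (ord a) \<otimes> b = b \<otimes> a [^] int (ord a)"
    using ord_pos[OF a_closed] by (simp add: int_pow_int)
  then have m: "0 < m" "a [^] int m \<otimes> b = b \<otimes> a [^] int m"
    unfolding m_def by (metis (mono_tags, lifting) LeastI)+
  have m_least: "m \<le> k" if "0 < k" "a [^] int k \<otimes> b = b \<otimes> a [^] int k" for k
    unfolding m_def using that by (intro Least_le) auto
  \<comment> \<open>Here \<open>g\<close> names the coset \<open>b^g <a>\<close> containing
    \<open>a^i b\<close>, reduced modulo \<open>ord b\<close>. The value \<open>0\<close> is
    excluded because it would put \<open>b\<close> into \<open><a>\<close> and make it
    trivial.\<close>
  have "\<exists>g h. a [^] int i \<otimes> b = b [^] g \<otimes> a [^] (h::int) \<and> g \<in> {1..<q}" for i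
  proof -
    obtain g h :: int where gh: "a [^] int i \<otimes> b = b [^] g \<otimes> a [^] h"
      using factorization'[of "a [^] int i \<otimes> b"] by auto
    have eq: "b [^] (g mod q) = b [^] g"
      by (subst int_pow_eq) (auto simp: q_def mod_eq_dvd_iff[symmetric])
    have "g mod q \<noteq> 0"
    proof
      assume "g mod q = 0"
      then have "a [^] int i \<otimes> b = a [^] h"
        using gh eq by simp
      then have "b [^] (1::int) = a [^] (h - int i)"
        by (simp add: int_pow_diff) (metis a_closed b_closed int_pow_closed inv_solve_left
            int_pow_mult int_pow_neg add.commute uminus_add_conv_diff)
      then have "b [^] (1::int) = \<one>" using powers_disjoint by metis
      with assms show False by simp
    qed
    then have "g mod q \<in> {1..<q}"
      using q pos_mod_bound[of q g] pos_mod_sign[of q g] by (auto simp del: pos_mod_bound pos_mod_sign)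
    then show ?thesis using gh eq by metis
  qed
  then obtain g h where gh: "\<And>i. a [^] int i \<otimes> b = b [^] g i \<otimes> a [^] (h i::int)"
    and g: "\<And>i. g i \<in> {1..<q}" by metis
  \<comment> \<open>Equal cosets for \<open>i < j < m\<close> would make \<open>a^(j - i)\<close>
    commute with \<open>b\<close>, against the minimality of \<open>m\<close>.\<close>
  have "inj_on g {..<m}"
  proof (rule linorder_inj_onI')
    fix i j assume ij: "i \<in> {..<m}" "j \<in> {..<m}" "i < j"
    show "g i \<noteq> g j"
    proof
      assume eq: "g i = g j"
      have "a [^] int (j - i) \<otimes> b = a [^] (- int i) \<otimes> (a [^] int j \<otimes> b)"
        using ij by (simp add: int_pow_mult[symmetric] m_assoc[symmetric] of_nat_diff)
      also have "\<dots> = a [^] (- int i) \<otimes> (b [^] g i \<otimes> a [^] h j)"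
        by (simp add: gh eq)
      also have "b [^] g i \<otimes> a [^] h j = (b [^] g i \<otimes> a [^] h i) \<otimes> a [^] (h j - h i)"
        by (simp add: int_pow_mult[symmetric] m_assoc)
      also have "\<dots> = a [^] int i \<otimes> b \<otimes> a [^] (h j - h i)" by (simp add: gh)
      also have "a [^] (- int i) \<otimes> \<dots> = b \<otimes> a [^] (h j - h i)"
        by (simp add: int_pow_neg m_assoc[symmetric])
      finally have "inv b \<otimes> a [^] int (j - i) \<otimes> b = a [^] (h j - h i)"
        by (simp add: m_assoc) (simp flip: m_assoc)
      then have "a [^] int (j - i) \<otimes> b = b \<otimes> a [^] int (j - i)"
        by (rule conj_power_commutes)
      with m_least[of "j - i"] ij show False by auto
    qed
  qed
  moreover have "g ` {..<m} \<subseteq> {1..<q}" using g by auto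
  ultimately have "card {..<m} \<le> card {1..<q}"
    by (intro card_inj_on_le) auto
  then have "m < ord b" using q by (simp add: q_def)
  with m that show thesis by blast
qed

text \<open>Pigeonhole: the conjugates of the \<open>ord b\<close> powers of \<open>b\<close> have
  \<open>a\<close>-exponents with at most \<open>m < ord b\<close> residues modulo the central
  exponent \<open>m\<close>. Dividing two conjugates with equal residues leaves a central power of
  \<open>a\<close> as the \<open>a\<close>-part.\<close>

lemma conj_in_center_times_powers:
  assumes "b \<noteq> \<one>"
  obtains n :: nat and u w :: int where "0 < n" "n < ord b"
    "a \<otimes> b [^] int n \<otimes> inv a = a [^] u \<otimes> b [^] w" "a [^] u \<otimes> b = b \<otimes> a [^] u"
proof -
  obtain m where m: "0 < m" "m < ord b" "a [^] int m \<otimes> b = b \<otimes> a [^] int m"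
    using central_power[OF assms] .
  have "\<exists>(f::int) (g::int). a \<otimes> b [^] int i \<otimes> inv a = a [^] f \<otimes> b [^] g" for i
    using factorization[of "a \<otimes> b [^] int i \<otimes> inv a"] by simp
  then obtain f g :: "nat \<Rightarrow> int"
    where fg: "\<And>i. a \<otimes> b [^] int i \<otimes> inv a = a [^] f i \<otimes> b [^] g i" by metis
  have "\<not> inj_on (\<lambda>i. f i mod int m) {..<ord b}"
  proof
    assume "inj_on (\<lambda>i. f i mod int m) {..<ord b}"
    moreover have "(\<lambda>i. f i mod int m) ` {..<ord b} \<subseteq> {0..<int m}"
      using m(1) by auto
    ultimately have "card {..<ord b} \<le> card {0..<int m}"
      by (intro card_inj_on_le) auto
    with m(2) show False by simp
  qed
  then obtain i j where ij: "i < j" "j < ord b" "f i mod int m = f j mod int m"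
    by (auto simp: inj_on_def) (metis linorder_neqE_nat)
  then obtain t where t: "f j - f i = int m * t"
    by (metis mod_eq_dvd_iff dvdE)
  have comm: "a [^] (f j - f i) \<otimes> b = b \<otimes> a [^] (f j - f i)"
    using commute_int_pow[OF _ _ m(3), of t] by (simp add: t int_pow_pow)
  \<comment> \<open>The exponent \<open>f j - f i\<close> is a multiple of \<open>m\<close>, so this
    power can be moved to the left past any power of \<open>b\<close>.\<close>
  have comm': "b [^] k \<otimes> a [^] (f j - f i) = a [^] (f j - f i) \<otimes> b [^] k" for k :: int
    by (rule commute_int_pow) (auto simp: comm)
  have "a \<otimes> b [^] int (j - i) \<otimes> inv a = inv (a \<otimes> b [^] int i \<otimes> inv a) \<otimes> (a \<otimes> b [^] int j \<otimes> inv a)"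
  proof -
    have "a \<otimes> b [^] int j \<otimes> inv a = a \<otimes> b [^] (int i + int (j - i)) \<otimes> inv a"
      using ij by (simp add: of_nat_diff)
    also have "\<dots> = (a \<otimes> b [^] int i \<otimes> inv a) \<otimes> (a \<otimes> b [^] int (j - i) \<otimes> inv a)"
      by (subst (1 2 3) conj_int_pow) (auto simp: int_pow_mult)
    finally show ?thesis by (simp add: inv_solve_left)
  qed
  also have "\<dots> = b [^] (- g i) \<otimes> a [^] (- f i) \<otimes> (a [^] f j \<otimes> b [^] g j)"
    by (simp add: fg inv_mult_group int_pow_neg)
  also have "\<dots> = b [^] (- g i) \<otimes> a [^] (f j - f i) \<otimes> b [^] g j"
    by (simp add: m_assoc[symmetric]) (simp add: m_assoc int_pow_mult[symmetric])
  also have "\<dots> = a [^] (f j - f i) \<otimes> b [^] (g j - g i)"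
    unfolding comm' by (simp add: m_assoc int_pow_mult[symmetric])
  finally have "a \<otimes> b [^] int (j - i) \<otimes> inv a = a [^] (f j - f i) \<otimes> b [^] (g j - g i)" .
  with comm ij show thesis by (intro that[of "j - i"]) auto
qed

section \<open>Normal subgroups \<open><a^u><b^n>\<close>\<close>

lemma normal_if_invariant_under_generators:
  assumes N: "subgroup N G"
    and inva: "\<And>x. x \<in> N \<Longrightarrow> a \<otimes> x \<otimes> inv a \<in> N"
    and invb: "\<And>x. x \<in> N \<Longrightarrow> b \<otimes> x \<otimes> inv b \<in> N"
  shows "N \<lhd> G"
proof -
  have powers: "c [^] (i::int) \<otimes> x \<otimes> inv (c [^] i) \<in> N"
    if c: "c \<in> carrier G" "\<And>x. x \<in> N \<Longrightarrow> c \<otimes> x \<otimes> inv c \<in> N" and x: "x \<in> N" for c i x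
  proof -
    have nat: "c [^] (k::nat) \<otimes> x \<otimes> inv (c [^] k) \<in> N" if "x \<in> N" for k x
      using that
    proof (induction k arbitrary: x)
      case (Suc k)
      have "x \<in> carrier G" by (rule subgroup.mem_carrier[OF N Suc.prems])
      then have "c [^] Suc k \<otimes> x \<otimes> inv (c [^] Suc k) = c [^] k \<otimes> (c \<otimes> x \<otimes> inv c) \<otimes> inv (c [^] k)"
        using c(1) by (simp add: inv_mult_group m_assoc)
      then show ?case using Suc.IH[OF c(2)[OF Suc.prems]] by simp
    qed (use subgroup.mem_carrier[OF N] in auto)
    \<comment> \<open>Finite order replaces the integer exponent by a natural one, so conjugation by
      inverses is covered by the induction.\<close>
    have "c [^] i = c [^] nat (i mod int (ord c))"
      using c(1) ord_pos[OF c(1)]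
      by (simp flip: int_pow_int add: int_pow_eq) (simp add: mod_eq_dvd_iff[symmetric])
    with nat[OF x] show ?thesis by simp
  qed
  show ?thesis
    unfolding normal_inv_iff
  proof (intro conjI ballI)
    fix g x assume g: "g \<in> carrier G" and x: "x \<in> N"
    obtain i j :: int where ij: "g = a [^] i \<otimes> b [^] j" using factorization[OF g] by blast
    have "x \<in> carrier G" by (rule subgroup.mem_carrier[OF N x])
    then have "g \<otimes> x \<otimes> inv g = a [^] i \<otimes> (b [^] j \<otimes> x \<otimes> inv (b [^] j)) \<otimes> inv (a [^] i)"
      by (simp add: ij inv_mult_group m_assoc)
    with powers[OF a_closed inva powers[OF b_closed invb x]] show "g \<otimes> x \<otimes> inv g \<in> N"
      by simp
  qed (rule N)
qed

text \<open>Write \<open>k = a^u\<close>, \<open>x = b^n\<close> and raise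
  \<open>a x a^-1 = k b^w\<close> to the power \<open>ord x\<close>. Exactness of the factorization
  makes the powers of \<open>k\<close> and of \<open>b^w\<close> trivial separately. The first gives
  the divisibility of orders; the second places \<open>b^w\<close> in \<open><x>\<close>, so
  conjugation by \<open>a\<close> preserves \<open><k><x>\<close>. The case \<open>u = 0\<close>
  covers a power of \<open>b\<close> that \<open>a\<close> conjugates into
  \<open><b>\<close>.\<close>

lemma normal_of_conj:
  fixes n u w :: int
  assumes conj: "a \<otimes> b [^] n \<otimes> inv a = a [^] u \<otimes> b [^] w"
    and central: "a [^] u \<otimes> b = b \<otimes> a [^] u"
  defines "N \<equiv> {(a [^] u) [^] (i::int) \<otimes> (b [^] n) [^] (j::int) | i j. True}"
  shows "N \<lhd> G" and "ord (a [^] u) dvd ord (b [^] n)"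
proof -
  define k x where "k = a [^] u" and "x = b [^] n"
  define r where "r = int (ord x)"
  have [simp]: "k \<in> carrier G" "x \<in> carrier G" by (auto simp: k_def x_def)
  have N: "N = {k [^] (i::int) \<otimes> x [^] (j::int) | i j. True}"
    by (simp add: N_def k_def x_def)
  have kb: "b [^] (i::int) \<otimes> k [^] (j::int) = k [^] j \<otimes> b [^] i" for i j
    using central by (intro commute_int_pow sym[OF commute_int_pow]) (auto simp: k_def)
  have ka: "a \<otimes> k [^] (j::int) = k [^] j \<otimes> a" for j
    using int_pow_mult[of a 1 "u * j"] int_pow_mult[of a "u * j" 1]
    by (simp add: k_def int_pow_pow add.commute)
  have xk: "x [^] (i::int) \<otimes> k [^] (j::int) = k [^] j \<otimes> x [^] i" for i j
    unfolding x_def by (simp add: int_pow_pow kb)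
  have conj': "a \<otimes> x [^] j \<otimes> inv a = k [^] j \<otimes> (b [^] w) [^] j" for j :: int
  proof -
    have "k \<otimes> b [^] w = b [^] w \<otimes> k" using kb[of w 1] by simp
    then have "(k \<otimes> b [^] w) [^] j = k [^] j \<otimes> (b [^] w) [^] j"
      by (intro int_pow_mult_distrib) auto
    then show ?thesis
      using conj conj_int_pow[of a x j] by (simp add: x_def k_def)
  qed
  have "k [^] r \<otimes> (b [^] w) [^] r = a \<otimes> x [^] r \<otimes> inv a" by (simp add: conj')
  also have "\<dots> = \<one>" by (simp add: r_def int_pow_int)
  finally have "a [^] (u * r) \<otimes> b [^] (w * r) = \<one>" by (simp add: k_def int_pow_pow)
  from powers_product_eq_one[OF this] have kr: "k [^] r = \<one>" and wr: "b [^] (w * r) = \<one>"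
    by (auto simp: k_def int_pow_pow)
  show "ord (a [^] u) dvd ord (b [^] n)"
    using kr by (simp add: int_pow_eq_id k_def x_def r_def)
  \<comment> \<open>Since \<open>r\<close> is \<open>ord b\<close> divided by
    \<open>gcd n (ord b)\<close>, cancelling \<open>r\<close> shows that this gcd divides
    \<open>w\<close>, which means that \<open>b^w\<close> is a power of \<open>x\<close>.\<close>
  have "int (ord b) dvd w * r" using wr by (simp add: int_pow_eq_id)
  moreover have rd: "r * gcd n (int (ord b)) = int (ord b)"
    using ord_int_pow[of b n] ord_pos by (simp add: r_def x_def)
  moreover have "r > 0" using ord_pos[of x] by (simp add: r_def)
  ultimately have "gcd n (int (ord b)) dvd w"
    by (metis dvd_mult_cancel_left mult.commute order_less_irrefl)
  then obtain t :: int where t: "b [^] w = x [^] t"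
    using int_pow_mem_powers_iff[of b w n] by (auto simp: x_def)
  have mult: "(k [^] i \<otimes> x [^] j) \<otimes> (k [^] i' \<otimes> x [^] j') = k [^] (i + i') \<otimes> x [^] (j + j')"
    for i j i' j' :: int
    by (simp add: int_pow_mult m_assoc) (simp add: m_assoc[symmetric] xk)
  have N_int: "k [^] (i::int) \<otimes> x [^] (j::int) \<in> N" for i j
    unfolding N by blast
  have sub: "subgroup N G"
  proof (rule subgroupI)
    show "N \<subseteq> carrier G" "N \<noteq> {}" by (auto simp: N)
  next
    fix y assume "y \<in> N"
    then obtain i j :: int where y: "y = k [^] i \<otimes> x [^] j" by (auto simp: N)
    have "inv y = k [^] (-i) \<otimes> x [^] (-j)"
      by (simp add: y inv_mult_group int_pow_neg[symmetric] xk)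
    then show "inv y \<in> N" by (simp add: N_int)
  next
    fix y z assume "y \<in> N" "z \<in> N"
    then obtain i j i' j' :: int where "y = k [^] i \<otimes> x [^] j" "z = k [^] i' \<otimes> x [^] j'"
      unfolding N by blast
    then show "y \<otimes> z \<in> N" by (simp add: mult N_int)
  qed
  show "N \<lhd> G"
  proof (rule normal_if_invariant_under_generators[OF sub])
    fix y assume "y \<in> N"
    then obtain i j :: int where y: "y = k [^] i \<otimes> x [^] j" by (auto simp: N)
    have "a \<otimes> y \<otimes> inv a = k [^] i \<otimes> (a \<otimes> x [^] j \<otimes> inv a)"
      by (simp add: y m_assoc[symmetric] ka)
    also have "\<dots> = k [^] i \<otimes> (k [^] j \<otimes> x [^] (t * j))"
      by (simp add: conj' t int_pow_pow)
    also have "\<dots> = k [^] (i + j) \<otimes> x [^] (t * j)"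
      by (simp add: m_assoc[symmetric] int_pow_mult)
    finally show "a \<otimes> y \<otimes> inv a \<in> N" by (simp add: N_int)
    have bx: "b \<otimes> x [^] j = x [^] j \<otimes> b"
      using int_pow_mult[of b 1 "n * j"] int_pow_mult[of b "n * j" 1]
      by (simp add: x_def int_pow_pow add.commute)
    have "b \<otimes> y = y \<otimes> b"
      using kb[of 1 i] bx by (simp add: y m_assoc[symmetric]) (simp add: m_assoc)
    then have "b \<otimes> y \<otimes> inv b = y" by (simp add: y m_assoc)
    then show "b \<otimes> y \<otimes> inv b \<in> N" using \<open>y \<in> N\<close> by simp
  qed
qed

text \<open>\<open>p'\<close> and \<open>q'\<close> are the orders of \<open>a\<close> and \<open>b\<close> modulo \<open>N\<close>, and the second condition says that
  \<open>\<langle>a\<rangle>N \<inter> \<langle>b\<rangle>N = N\<close>. The divisibility makes \<open>p' dvd 2 * q'\<close> lift to \<open>ord a dvd 2 * ord b\<close>.\<close>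

definition admissible :: "'a set \<Rightarrow> nat \<Rightarrow> nat \<Rightarrow> bool" where
  "admissible N p' q' \<longleftrightarrow> N \<lhd> G \<and>
     (\<forall>(i::int) (j::int). a [^] i \<otimes> b [^] j \<in> N \<longrightarrow> a [^] i \<in> N) \<and>
     (\<forall>n::int. a [^] n \<in> N \<longleftrightarrow> int p' dvd n) \<and>
     (\<forall>n::int. b [^] n \<in> N \<longleftrightarrow> int q' dvd n) \<and>
     ord a * q' dvd ord b * p'"

text \<open>The subgroup \<open><k><x>\<close> of \<open>normal_of_conj\<close> is admissible: the
  orders modulo it are gcds, and the last condition is \<open>ord k dvd ord x\<close> multiplied by
  \<open>p' * q'\<close>.\<close>

lemma admissible_nontrivial:
  assumes "b \<noteq> \<one>"
  obtains N p' q' where "admissible N p' q'" "N \<noteq> {\<one>}"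
proof -
  obtain n :: nat and u w :: int where n: "0 < n" "n < ord b"
    and conj: "a \<otimes> b [^] int n \<otimes> inv a = a [^] u \<otimes> b [^] w"
    and comm: "a [^] u \<otimes> b = b \<otimes> a [^] u"
    using conj_in_center_times_powers[OF assms] .
  define N where "N = {(a [^] u) [^] (i::int) \<otimes> (b [^] int n) [^] (j::int) | i j. True}"
  note nc = normal_of_conj[OF conj comm, folded N_def]
  define p' q' where "p' = nat (gcd u (int (ord a)))" and "q' = nat (gcd (int n) (int (ord b)))"
  have p': "int p' = gcd u (int (ord a))" and q': "int q' = gcd (int n) (int (ord b))"
    by (simp_all add: p'_def q'_def)
  have p: "ord a = ord (a [^] u) * p'"
    using ord_int_pow[of a u] ord_pos by (metis a_closed of_nat_eq_iff of_nat_mult p')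
  have q: "ord b = ord (b [^] int n) * q'"
    using ord_int_pow[of b "int n"] ord_pos by (metis b_closed of_nat_eq_iff of_nat_mult q')
  \<comment> \<open>Uniqueness of the factorization splits membership in \<open>N\<close> into one
    condition for each factor.\<close>
  have key: "\<exists>(i'::int) (j'::int). a [^] i = (a [^] u) [^] i' \<and> b [^] j = (b [^] int n) [^] j'"
    if mem: "a [^] i \<otimes> b [^] j \<in> N" for i j :: int
  proof -
    obtain i' j' :: int where "a [^] i \<otimes> b [^] j = a [^] (u * i') \<otimes> b [^] (int n * j')"
      using mem by (auto simp: N_def int_pow_pow)
    then have "a [^] (- (u * i')) \<otimes> (a [^] i \<otimes> b [^] j) \<otimes> b [^] (- (int n * j')) = \<one>"
      by (simp add: int_pow_neg) (simp add: m_assoc)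
    then have "a [^] (i - u * i') \<otimes> b [^] (j - int n * j') = \<one>"
      by (simp add: m_assoc int_pow_mult[symmetric]) (simp add: m_assoc[symmetric] int_pow_mult[symmetric])
    from powers_product_eq_one[OF this] show ?thesis
      by (intro exI[of _ i'] exI[of _ j']) (simp add: int_pow_pow int_pow_eq int_pow_eq_id dvd_diff_commute)
  qed
  have N1: "(a [^] u) [^] (i::int) \<in> N" for i
    unfolding N_def by (rule CollectI, rule exI[of _ i], rule exI[of _ 0]) simp
  have N2: "(b [^] int n) [^] (j::int) \<in> N" for j
    unfolding N_def by (rule CollectI, rule exI[of _ 0], rule exI[of _ j]) simp
  have "a [^] i \<in> N" if "a [^] i \<otimes> b [^] j \<in> N" for i j :: int
    using key[OF that] N1 by metis
  moreover have "a [^] i \<in> N \<longleftrightarrow> int p' dvd i" for i :: int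
    unfolding p' int_pow_mem_powers_iff[OF a_closed, symmetric]
    using key[of i 0] N1 by auto
  moreover have "b [^] i \<in> N \<longleftrightarrow> int q' dvd i" for i :: int
    unfolding q' int_pow_mem_powers_iff[OF b_closed, symmetric]
    using key[of 0 i] N2 by auto
  moreover have "ord a * q' dvd ord b * p'"
  proof -
    have "ord (a [^] u) * (p' * q') dvd ord (b [^] int n) * (p' * q')"
      using nc(2) by (rule mult_dvd_mono) simp
    then show ?thesis by (metis p q mult.assoc mult.commute)
  qed
  ultimately have "admissible N p' q'" using nc(1) by (auto simp: admissible_def)
  moreover have "b [^] int n \<in> N" using N2[of 1] by simp
  \<comment> \<open>The bounds \<open>0 < n < ord b\<close> ensure that \<open>N\<close> contains a
    nontrivial element.\<close>
  moreover have "b [^] int n \<noteq> \<one>"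
    using n by (auto simp: int_pow_eq_id dest: zdvd_imp_le)
  ultimately show thesis using that by blast
qed

text \<open>This provides a first candidate for the choice of a maximal admissible subgroup.\<close>

lemma admissible_trivial: "admissible {\<one>} (ord a) (ord b)"
  using powers_product_eq_one one_is_normal by (auto simp: admissible_def int_pow_eq_id)

text \<open>All results of the locale become available in the quotient, with \<open>p'\<close> and
  \<open>q'\<close> as the new orders.\<close>

lemma admissible_quotient:
  assumes "admissible N p' q'"
  shows "cyclic_factorization (G Mod N) (N #> a) (N #> b)"
    and "group.ord (G Mod N) (N #> a) = p'" and "group.ord (G Mod N) (N #> b) = q'"
proof -
  interpret N: normal N G using assms by (simp add: admissible_def)
  interpret Q: group "G Mod N" by (rule N.factorgroup_is_group)
  interpret h: group_hom G "G Mod N" "\<lambda>x. N #> x"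
    by unfold_locales (rule N.r_coset_hom_Mod)
  have one: "N #> x = \<one>\<^bsub>G Mod N\<^esub> \<longleftrightarrow> x \<in> N" if "x \<in> carrier G" for x
    using that by (metis FactGroup_def N.is_subgroup coset_join1 coset_join2 monoid.select_convs(2) N.subset)
  have pow: "(N #> x) [^]\<^bsub>G Mod N\<^esub> (i::int) = N #> (x [^] i)" if "x \<in> carrier G" for x i
    using h.hom_int_pow[OF that] by simp
  have ord: "Q.ord (N #> x) = k" if "x \<in> carrier G" "\<And>i::int. x [^] i \<in> N \<longleftrightarrow> int k dvd i" for x k
    unfolding Q.ord_unique[OF h.hom_closed[OF that(1)]]
    using that by (simp flip: int_pow_int add: pow one del: one_FactGroup)
  show p: "Q.ord (N #> a) = p'" and q: "Q.ord (N #> b) = q'"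
    using assms by (auto intro!: ord simp: admissible_def)
  \<comment> \<open>The order of the image of \<open>b\<close> divides the order of
    \<open>b\<close>, so it stays odd.\<close>
  have "int q' dvd int (ord b)"
  proof -
    have "b [^] int (ord b) \<in> N" by (simp add: int_pow_int N.one_closed)
    then show ?thesis using assms by (simp add: admissible_def)
  qed
  then have "odd q'" using odd_ord by (meson dvd_trans int_dvd_int_iff)
  show "cyclic_factorization (G Mod N) (N #> a) (N #> b)"
  proof
    show "finite (carrier (G Mod N))"
      using finite_carrier by (simp add: carrier_FactGroup)
    show "odd (Q.ord (N #> b))" using q \<open>odd q'\<close> by simp
    show "(N #> a) \<otimes>\<^bsub>G Mod N\<^esub> (N #> b) \<otimes>\<^bsub>G Mod N\<^esub> ((N #> a) \<otimes>\<^bsub>G Mod N\<^esub> (N #> b)) = \<one>\<^bsub>G Mod N\<^esub>"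
      using h.hom_mult[of "a \<otimes> b" "a \<otimes> b"] h.hom_mult[of a b] by (simp add: involution)
  next
    fix X assume "X \<in> carrier (G Mod N)"
    then obtain x where x: "x \<in> carrier G" "X = N #> x" by (auto simp: carrier_FactGroup)
    obtain i j :: int where "x = a [^] i \<otimes> b [^] j" using factorization x(1) by blast
    then have "X = (N #> a) [^]\<^bsub>G Mod N\<^esub> i \<otimes>\<^bsub>G Mod N\<^esub> (N #> b) [^]\<^bsub>G Mod N\<^esub> j"
      using x by (simp add: pow)
    then show "\<exists>(i::int) (j::int). X = (N #> a) [^]\<^bsub>G Mod N\<^esub> i \<otimes>\<^bsub>G Mod N\<^esub> (N #> b) [^]\<^bsub>G Mod N\<^esub> j"
      by blast
  next
    fix i j :: int assume eq: "(N #> a) [^]\<^bsub>G Mod N\<^esub> i = (N #> b) [^]\<^bsub>G Mod N\<^esub> j"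
    \<comment> \<open>Equality of the two powers puts \<open>a^i b^(-j)\<close> into
      \<open>N\<close>; the second condition of \<open>admissible\<close> then puts
      \<open>a^i\<close> into \<open>N\<close>.\<close>
    have "(N #> a) [^]\<^bsub>G Mod N\<^esub> i \<otimes>\<^bsub>G Mod N\<^esub> (N #> b) [^]\<^bsub>G Mod N\<^esub> (-j) = \<one>\<^bsub>G Mod N\<^esub>"
      unfolding eq using Q.int_pow_mult[of "N #> b" j "-j"] by simp
    then have "a [^] i \<otimes> b [^] (-j) \<in> N"
      using one[of "a [^] i \<otimes> b [^] (-j)"] h.hom_mult[of "a [^] i" "b [^] (-j)"] by (simp add: pow)
    then have "a [^] i \<in> N" using assms by (auto simp: admissible_def)
    then show "(N #> a) [^]\<^bsub>G Mod N\<^esub> i = \<one>\<^bsub>G Mod N\<^esub>"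
      using one[of "a [^] i"] by (simp add: pow)
  qed auto
qed

text \<open>A nontrivial admissible subgroup of the quotient by \<open>N\<close> is pulled back to
  \<open>G\<close>.\<close>

lemma admissible_extend:
  assumes adm: "admissible N p' q'" and "b \<notin> N"
  obtains M p'' q'' where "admissible M p'' q''" "N \<subset> M"
proof -
  interpret N: normal N G using adm by (simp add: admissible_def)
  interpret Q: cyclic_factorization "G Mod N" "N #> a" "N #> b"
    by (rule admissible_quotient[OF adm])
  interpret h: group_hom G "G Mod N" "\<lambda>x. N #> x"
    by unfold_locales (rule N.r_coset_hom_Mod)
  note ords = admissible_quotient(2,3)[OF adm]
  have one: "N #> x = \<one>\<^bsub>G Mod N\<^esub> \<longleftrightarrow> x \<in> N" if "x \<in> carrier G" for x
    using that by (metis FactGroup_def N.is_subgroup coset_join1 coset_join2 monoid.select_convs(2) N.subset)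
  have pow: "(N #> x) [^]\<^bsub>G Mod N\<^esub> (i::int) = N #> (x [^] i)" if "x \<in> carrier G" for x i
    using h.hom_int_pow[OF that] by simp
  have "N #> b \<noteq> \<one>\<^bsub>G Mod N\<^esub>" using \<open>b \<notin> N\<close> one by blast
  then obtain X p'' q'' where X: "Q.admissible X p'' q''" "X \<noteq> {\<one>\<^bsub>G Mod N\<^esub>}"
    by (rule Q.admissible_nontrivial)
  interpret X: normal X "G Mod N" using X(1) by (simp add: Q.admissible_def)
  define M where "M = {x \<in> carrier G. N #> x \<in> X}"
  have M_iff: "x \<in> M \<longleftrightarrow> N #> x \<in> X" if "x \<in> carrier G" for x
    using that by (simp add: M_def)
  have "subgroup M G"
  proof (rule subgroupI)
    show "M \<noteq> {}" using M_iff[OF one_closed] X.one_closed h.hom_one by auto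
    show "x \<otimes> y \<in> M" if "x \<in> M" "y \<in> M" for x y
      using that X.m_closed[of "N #> x" "N #> y"] h.hom_mult[of x y] by (simp add: M_def)
    show "inv x \<in> M" if "x \<in> M" for x
      using that X.m_inv_closed[of "N #> x"] h.hom_inv[of x] by (simp add: M_def)
  qed (auto simp: M_def)
  then have "M \<lhd> G"
    unfolding normal_inv_iff
  proof (intro conjI ballI)
    fix x y assume "x \<in> carrier G" "y \<in> M"
    moreover from this have "N #> (x \<otimes> y \<otimes> inv x) = (N #> x) \<otimes>\<^bsub>G Mod N\<^esub> (N #> y) \<otimes>\<^bsub>G Mod N\<^esub> inv\<^bsub>G Mod N\<^esub> (N #> x)"
      using h.hom_mult[of "x \<otimes> y" "inv x"] h.hom_mult[of x y] h.hom_inv[of x] by (simp add: M_def)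
    ultimately show "x \<otimes> y \<otimes> inv x \<in> M"
      using X.inv_op_closed2[of "N #> x" "N #> y"] by (simp add: M_def)
  qed
  moreover have "N \<subset> M"
  proof -
    have "x \<in> M" if "x \<in> N" for x
      using that one[of x] N.mem_carrier X.one_closed by (simp add: M_def)
    then have "N \<subseteq> M" by blast
    moreover obtain Y where "Y \<in> X" "Y \<noteq> \<one>\<^bsub>G Mod N\<^esub>" using X(2) X.one_closed by blast
    then obtain x where x: "x \<in> carrier G" "Y = N #> x"
      using X.mem_carrier by (auto simp: carrier_FactGroup)
    moreover have "x \<notin> N" using one[OF x(1)] x(2) \<open>Y \<noteq> \<one>\<^bsub>G Mod N\<^esub>\<close> by simp
    ultimately show ?thesis using \<open>Y \<in> X\<close> by (auto simp: M_def)
  qed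
  \<comment> \<open>The divisibilities for \<open>N\<close> in \<open>G\<close> and for
    \<open>X\<close> in the quotient multiply, and the common factor \<open>p' * q'\<close>
    cancels.\<close>
  moreover have "ord a * q'' dvd ord b * p''"
  proof -
    have 1: "ord a * q' dvd ord b * p'" using adm by (simp add: admissible_def)
    have 2: "p' * q'' dvd q' * p''" using X(1) by (simp add: Q.admissible_def ords)
    have "(p' * q') * (ord a * q'') dvd (p' * q') * (ord b * p'')"
      using mult_dvd_mono[OF 1 2] by (simp add: ac_simps)
    moreover have "p' * q' > 0"
      using Q.ord_pos[of "N #> a"] Q.ord_pos[of "N #> b"] by (simp add: ords)
    ultimately show ?thesis by simp
  qed
  ultimately have "admissible M p'' q''"
    using X(1) by (auto simp: admissible_def Q.admissible_def M_iff pow)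
  with \<open>N \<subset> M\<close> show thesis by (rule that[rotated])
qed

text \<open>A maximal admissible \<open>N\<close> contains \<open>b\<close>, by
  \<open>admissible_extend\<close>. Modulo \<open>N\<close> the relation \<open>(a b)^2 = 1\<close>
  becomes \<open>a^2 = 1\<close>, so \<open>q' = 1\<close> and \<open>p' dvd 2\<close>; the last
  condition of \<open>admissible\<close> lifts this to \<open>G\<close>.\<close>

theorem ord_dvd_twice: "ord a dvd 2 * ord b"
proof -
  define S where "S = {N. \<exists>p' q'. admissible N p' q'}"
  have "S \<subseteq> Pow (carrier G)"
    by (auto simp: S_def admissible_def dest: normal_imp_subgroup subgroup.mem_carrier)
  then have "finite S" using finite_carrier by (meson finite_Pow_iff finite_subset)
  moreover have "S \<noteq> {}" using admissible_trivial by (auto simp: S_def)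
  ultimately obtain N where N: "N \<in> S" "\<And>M. M \<in> S \<Longrightarrow> N \<subseteq> M \<Longrightarrow> N = M"
    by (metis finite_has_maximal)
  then obtain p' q' where adm: "admissible N p' q'" by (auto simp: S_def)
  have bN: "b \<in> N"
  proof (rule ccontr)
    assume "b \<notin> N"
    then obtain M p'' q'' where "admissible M p'' q''" "N \<subset> M"
      using admissible_extend[OF adm] by metis
    then show False using N(2)[of M] by (auto simp: S_def)
  qed
  interpret N: normal N G using adm by (simp add: admissible_def)
  have "b [^] (1::int) \<in> N" using bN by simp
  then have "int q' dvd 1" using adm unfolding admissible_def by metis
  then have "q' = 1" by simp
  have "a \<otimes> b \<otimes> inv a \<in> N" using bN N.inv_op_closed2 by blast
  then have "a [^] (2::int) \<in> N"
  proof -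
    \<comment> \<open>The product collapses to \<open>a b a b\<close>.\<close>
    have "(a \<otimes> b \<otimes> inv a) \<otimes> (a [^] (2::int)) \<otimes> b = \<one>"
      using involution int_pow_mult[of a 1 1] by (simp add: m_assoc) (simp flip: m_assoc)
    then have "inv b = (a \<otimes> b \<otimes> inv a) \<otimes> a [^] (2::int)"
      by (intro inv_equality) auto
    then have "a [^] (2::int) = inv (a \<otimes> b \<otimes> inv a) \<otimes> inv b"
      by (subst inv_solve_left) auto
    then show ?thesis using bN \<open>a \<otimes> b \<otimes> inv a \<in> N\<close> by (simp add: N.m_inv_closed N.m_closed)
  qed
  then have "int p' dvd 2" using adm unfolding admissible_def by metis
  then have "p' dvd 2" by (metis int_dvd_int_iff of_nat_numeral)
  then have "ord b * p' dvd ord b * 2" by (rule mult_dvd_mono[OF dvd_refl])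
  moreover have "ord a dvd ord b * p'"
    using adm \<open>q' = 1\<close> by (simp add: admissible_def)
  ultimately show ?thesis by (metis dvd_trans mult.commute)
qed

text \<open>The order of \<open>a b\<close> is two and divides \<open>ord a * ord b\<close>, whose
  second factor is odd.\<close>

lemma even_ord:
  assumes "order G = ord a * ord b" "a \<otimes> b \<noteq> \<one>"
  shows "even (ord a)"
proof -
  have "(a \<otimes> b) [^] (2::nat) = \<one>"
    using involution by (simp add: numeral_2_eq_2)
  then have "ord (a \<otimes> b) dvd 2" by (simp add: pow_eq_id)
  moreover have "ord (a \<otimes> b) \<noteq> 1" using assms(2) ord_eq_1[of "a \<otimes> b"] by simp
  moreover have "0 < ord (a \<otimes> b)" by (simp add: ord_pos)
  ultimately have "ord (a \<otimes> b) = 2" using dvd_imp_le[of "ord (a \<otimes> b)" 2] by auto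
  then have "2 dvd ord a * ord b"
    using ord_dvd_group_order[of "a \<otimes> b"] assms(1) by simp
  then show ?thesis using odd_ord by simp
qed

text \<open>The cosets \<open>b^i a^-1 <b>\<close> all differ from \<open><b>\<close>, so at most
  \<open>ord a - 1\<close> occur. A coincidence for \<open>i < j < ord b\<close> would make
  \<open>a\<close> conjugate \<open>b^(j - i)\<close> into \<open><b>\<close>; its powers would then
  form a nontrivial normal subgroup inside \<open><b>\<close>.\<close>

lemma ord_less_if_core_free:
  assumes cf: "core_free G (generate G {b})" and "a \<noteq> \<one>"
  shows "ord b < ord a"
proof -
  define p where "p = int (ord a)"
  have p: "p > 0" using ord_pos[OF a_closed] by (simp add: p_def)
  have "\<exists>f g. b [^] int i \<otimes> inv a = a [^] f \<otimes> b [^] (g::int) \<and> f \<in> {1..<p}" for i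
  proof -
    obtain f g :: int where fg: "b [^] int i \<otimes> inv a = a [^] f \<otimes> b [^] g"
      using factorization[of "b [^] int i \<otimes> inv a"] by auto
    have eq: "a [^] (f mod p) = a [^] f"
      by (subst int_pow_eq) (auto simp: p_def mod_eq_dvd_iff[symmetric])
    have "f mod p \<noteq> 0"
    proof
      assume "f mod p = 0"
      then have "b [^] int i \<otimes> inv a = b [^] g"
        using fg eq by simp
      then have "a = b [^] (- g) \<otimes> b [^] int i"
        by (metis a_closed b_closed int_pow_closed int_pow_neg inv_closed inv_solve_left inv_solve_right)
      then have "a [^] (1::int) = b [^] (- g + int i)"
        using int_pow_mult[of b "- g" "int i"] by simp
      then have "a [^] (1::int) = \<one>" by (rule powers_disjoint)
      with \<open>a \<noteq> \<one>\<close> show False by simp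
    qed
    then have "f mod p \<in> {1..<p}"
      using p pos_mod_bound[of p f] pos_mod_sign[of p f] by (auto simp del: pos_mod_bound pos_mod_sign)
    then show ?thesis using fg eq by metis
  qed
  then obtain f g where fg: "\<And>i. b [^] int i \<otimes> inv a = a [^] f i \<otimes> b [^] (g i::int)"
    and f: "\<And>i. f i \<in> {1..<p}" by metis
  have "inj_on f {..<ord b}"
  proof (rule linorder_inj_onI')
    fix i j assume ij: "i \<in> {..<ord b}" "j \<in> {..<ord b}" "i < j"
    show "f i \<noteq> f j"
    proof
      assume eq: "f i = f j"
      define n where "n = int (j - i)"
      have "b [^] int j \<otimes> inv a = b [^] int i \<otimes> inv a \<otimes> b [^] (g j - g i)"
        unfolding fg eq by (simp add: m_assoc int_pow_mult[symmetric])
      moreover have "b [^] n = b [^] (- int i) \<otimes> b [^] int j"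
        using ij by (simp add: n_def int_pow_mult[symmetric] of_nat_diff)
      ultimately have "a \<otimes> b [^] n \<otimes> inv a = a \<otimes> b [^] (- int i) \<otimes> (b [^] int i \<otimes> inv a \<otimes> b [^] (g j - g i))"
        by (simp add: m_assoc)
      also have "\<dots> = b [^] (g j - g i)"
        by (simp add: int_pow_neg m_assoc) (simp flip: m_assoc)
      \<comment> \<open>The factor \<open>a^0\<close> brings the equation into the form of
        \<open>normal_of_conj\<close>.\<close>
      finally have conj: "a \<otimes> b [^] n \<otimes> inv a = a [^] (0::int) \<otimes> b [^] (g j - g i)" by simp
      define N where "N = {(a [^] (0::int)) [^] (k::int) \<otimes> (b [^] n) [^] (l::int) | k l. True}"
      have "N \<lhd> G" unfolding N_def by (rule normal_of_conj[OF conj]) simp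
      moreover have "N \<subseteq> generate G {b}"
        by (auto simp: N_def generate_pow int_pow_pow)
      ultimately have "N \<subseteq> {\<one>}" using cf unfolding core_free_def is_core_def by blast
      moreover have "(a [^] (0::int)) [^] (0::int) \<otimes> (b [^] n) [^] (1::int) \<in> N"
        unfolding N_def by blast
      ultimately have "b [^] n = \<one>" by auto
      then show False using ij zdvd_imp_le[of "int (ord b)" n]
        by (auto simp: int_pow_eq_id n_def)
    qed
  qed
  moreover have "f ` {..<ord b} \<subseteq> {1..<p}" using f by auto
  ultimately have "card {..<ord b} \<le> card {1..<p}"
    by (intro card_inj_on_le) auto
  then show ?thesis using p by (simp add: p_def)
qed

text \<open>As \<open>ord a\<close> divides \<open>2 * ord b\<close> and exceeds
  \<open>ord b\<close>, the quotient can only be \<open>1\<close>.\<close>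

theorem ord_eq_twice_if_core_free:
  assumes "core_free G (generate G {b})" "a \<noteq> \<one>"
  shows "ord a = 2 * ord b"
proof -
  obtain k where k: "2 * ord b = ord a * k" using ord_dvd_twice ..
  have "k < 2"
  proof (rule ccontr)
    assume "\<not> k < 2"
    then have "ord a * 2 \<le> 2 * ord b" unfolding k by simp
    then show False using ord_less_if_core_free[OF assms] by simp
  qed
  moreover have "k \<noteq> 0" using k ord_pos[OF b_closed] by (intro notI) simp
  ultimately have "k = 1" by simp
  with k show ?thesis by simp
qed

end

section \<open>Flags and automorphisms of polyhedra\<close>

lemma card_2_ex1_other:
  assumes "card S = 2" "x \<in> S"
  shows "\<exists>!y. y \<in> S \<and> y \<noteq> x"
  using assms by (auto simp: card_2_iff)

lemma all_le_two_iff: "(\<forall>j\<le>(2::nat). Q j) \<longleftrightarrow> Q 0 \<and> Q 1 \<and> Q 2"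
  by (auto simp: le_Suc_eq numeral_2_eq_2)

lemma le_two_cases:
  assumes "i \<le> (2::nat)"
  obtains "i = 0" | "i = 1" | "i = 2"
  using assms by linarith

text \<open>Connectedness enters only in this form: a property passed on by incidence spreads
  through the whole set.\<close>

lemma incidence_connected_induct:
  assumes "incidence_connected P S" "x \<in> S" "y \<in> S" "Q x"
    and step: "\<And>x y. \<lbrakk>x \<in> S; y \<in> S; incident P x y; Q x\<rbrakk> \<Longrightarrow> Q y"
  shows "Q y"
proof -
  have "(x, y) \<in> {(a, b). a \<in> S \<and> b \<in> S \<and> incident P a b}\<^sup>*"
    using assms by (simp add: incidence_connected_def)
  then show ?thesis
    by (induction rule: rtrancl_induct) (use \<open>Q x\<close> step in auto)
qed

context polyhedron
begin

lemma ord_trans: "(x, y) \<in> ord P \<Longrightarrow> (y, z) \<in> ord P \<Longrightarrow> (x, z) \<in> ord P"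
  using partial_order by (auto simp: partial_order_on_def preorder_on_def dest: transD)

lemma incident_commute: "incident P x y \<longleftrightarrow> incident P y x"
  by (auto simp: incident_def)

lemma incident_iff_ord: "rk P x < rk P y \<Longrightarrow> incident P x y \<longleftrightarrow> (x, y) \<in> ord P"
  using rank_strict_mono[of y x] by (auto simp: incident_def)

lemma incident_same_rank: "incident P x y \<Longrightarrow> rk P x = rk P y \<Longrightarrow> x = y"
  using rank_strict_mono[of x y] rank_strict_mono[of y x] by (auto simp: incident_def)

text \<open>Ranks fix the direction of each incidence, and transitivity supplies the one between
  vertex and face.\<close>

lemma flags_iff:
  "(v, e, f) \<in> flags P \<longleftrightarrow>
     v \<in> vertices P \<and> e \<in> edges P \<and> f \<in> faces P \<and> (v, e) \<in> ord P \<and> (e, f) \<in> ord P"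
  by (auto simp: flags_def elems_of_rank_def incident_iff_ord intro: ord_trans)

lemma rank_disjoint:
  "x \<in> vertices P \<Longrightarrow> x \<notin> edges P" "x \<in> vertices P \<Longrightarrow> x \<notin> faces P" "x \<in> edges P \<Longrightarrow> x \<notin> faces P"
  by (auto simp: elems_of_rank_def)

section \<open>Adjacent flags\<close>

lemma ex1_vertex:
  assumes "(v, e, f) \<in> flags P"
  shows "\<exists>!v'. (v', e, f) \<in> flags P \<and> v' \<noteq> v"
proof -
  have "card {v \<in> vertices P. incident P v e} = 2"
    using assms edge_vertices by (simp add: flags_iff)
  then have "\<exists>!v'. v' \<in> {v \<in> vertices P. incident P v e} \<and> v' \<noteq> v"
    using assms by (intro card_2_ex1_other) (auto simp: flags_def)
  moreover have "v' \<in> {v \<in> vertices P. incident P v e} \<longleftrightarrow> (v', e, f) \<in> flags P" for v'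
    using assms by (auto simp: flags_iff elems_of_rank_def incident_iff_ord)
  ultimately show ?thesis by (simp only:)
qed

lemma ex1_edge:
  assumes "(v, e, f) \<in> flags P"
  shows "\<exists>!e'. (v, e', f) \<in> flags P \<and> e' \<noteq> e"
proof -
  have "card {e \<in> edges P. incident P v e \<and> incident P e f} = 2"
    using assms diamond by (simp add: flags_def)
  then have "\<exists>!e'. e' \<in> {e \<in> edges P. incident P v e \<and> incident P e f} \<and> e' \<noteq> e"
    using assms by (intro card_2_ex1_other) (auto simp: flags_def)
  moreover have "e' \<in> {e \<in> edges P. incident P v e \<and> incident P e f} \<longleftrightarrow> (v, e', f) \<in> flags P" for e'
    using assms by (auto simp: flags_def)
  ultimately show ?thesis by (simp only:)
qed

lemma ex1_face:
  assumes "(v, e, f) \<in> flags P"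
  shows "\<exists>!f'. (v, e, f') \<in> flags P \<and> f' \<noteq> f"
proof -
  have "card {f \<in> faces P. incident P e f} = 2"
    using assms edge_faces by (simp add: flags_iff)
  then have "\<exists>!f'. f' \<in> {f \<in> faces P. incident P e f} \<and> f' \<noteq> f"
    using assms by (intro card_2_ex1_other) (auto simp: flags_def)
  moreover have "f' \<in> {f \<in> faces P. incident P e f} \<longleftrightarrow> (v, e, f') \<in> flags P" for f'
    using assms by (auto simp: flags_iff elems_of_rank_def incident_iff_ord)
  ultimately show ?thesis by (simp only:)
qed

text \<open>This justifies the definite description in \<open>adj_flag\<close>; each rank reduces to
  one of \<open>ex1_vertex\<close>, \<open>ex1_edge\<close>, \<open>ex1_face\<close>.\<close>

lemma ex1_adj_flag:
  assumes "\<Phi> \<in> flags P" "i \<le> 2"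
  shows "\<exists>!\<Psi>. \<Psi> \<in> flags P \<and> (\<forall>j\<le>2. flag_elem j \<Psi> \<noteq> flag_elem j \<Phi> \<longleftrightarrow> j = i)"
proof -
  obtain v e f where \<Phi>: "\<Phi> = (v, e, f)" by (cases \<Phi>)
  show ?thesis
    using assms(2)
  proof (cases rule: le_two_cases)
    case 1
    obtain v' where v': "(v', e, f) \<in> flags P" "v' \<noteq> v"
      "\<And>u. (u, e, f) \<in> flags P \<Longrightarrow> u \<noteq> v \<Longrightarrow> u = v'"
      using ex1_vertex[of v e f] assms(1) \<Phi> by blast
    show ?thesis
    proof (rule ex1I[of _ "(v', e, f)"])
      show "(v', e, f) \<in> flags P \<and> (\<forall>j\<le>2. flag_elem j (v', e, f) \<noteq> flag_elem j \<Phi> \<longleftrightarrow> j = i)"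
        using v'(1,2) 1 by (simp add: \<Phi> all_le_two_iff)
      fix \<Psi> assume *: "\<Psi> \<in> flags P \<and> (\<forall>j\<le>2. flag_elem j \<Psi> \<noteq> flag_elem j \<Phi> \<longleftrightarrow> j = i)"
      obtain v1 e1 f1 where \<Psi>: "\<Psi> = (v1, e1, f1)" by (cases \<Psi>)
      with * 1 have "e1 = e" "f1 = f" "v1 \<noteq> v" by (auto simp: \<Phi> all_le_two_iff)
      with * v'(3)[of v1] show "\<Psi> = (v', e, f)" by (simp add: \<Psi>)
    qed
  next
    case 2
    obtain e' where e': "(v, e', f) \<in> flags P" "e' \<noteq> e"
      "\<And>u. (v, u, f) \<in> flags P \<Longrightarrow> u \<noteq> e \<Longrightarrow> u = e'"
      using ex1_edge[of v e f] assms(1) \<Phi> by blast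
    show ?thesis
    proof (rule ex1I[of _ "(v, e', f)"])
      show "(v, e', f) \<in> flags P \<and> (\<forall>j\<le>2. flag_elem j (v, e', f) \<noteq> flag_elem j \<Phi> \<longleftrightarrow> j = i)"
        using e'(1,2) 2 by (simp add: \<Phi> all_le_two_iff)
      fix \<Psi> assume *: "\<Psi> \<in> flags P \<and> (\<forall>j\<le>2. flag_elem j \<Psi> \<noteq> flag_elem j \<Phi> \<longleftrightarrow> j = i)"
      obtain v1 e1 f1 where \<Psi>: "\<Psi> = (v1, e1, f1)" by (cases \<Psi>)
      with * 2 have "v1 = v" "f1 = f" "e1 \<noteq> e" by (auto simp: \<Phi> all_le_two_iff)
      with * e'(3)[of e1] show "\<Psi> = (v, e', f)" by (simp add: \<Psi>)
    qed
  next
    case 3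
    obtain f' where f': "(v, e, f') \<in> flags P" "f' \<noteq> f"
      "\<And>u. (v, e, u) \<in> flags P \<Longrightarrow> u \<noteq> f \<Longrightarrow> u = f'"
      using ex1_face[of v e f] assms(1) \<Phi> by blast
    show ?thesis
    proof (rule ex1I[of _ "(v, e, f')"])
      show "(v, e, f') \<in> flags P \<and> (\<forall>j\<le>2. flag_elem j (v, e, f') \<noteq> flag_elem j \<Phi> \<longleftrightarrow> j = i)"
        using f'(1,2) 3 by (simp add: \<Phi> all_le_two_iff)
      fix \<Psi> assume *: "\<Psi> \<in> flags P \<and> (\<forall>j\<le>2. flag_elem j \<Psi> \<noteq> flag_elem j \<Phi> \<longleftrightarrow> j = i)"
      obtain v1 e1 f1 where \<Psi>: "\<Psi> = (v1, e1, f1)" by (cases \<Psi>)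
      with * 3 have "v1 = v" "e1 = e" "f1 \<noteq> f" by (auto simp: \<Phi> all_le_two_iff)
      with * f'(3)[of f1] show "\<Psi> = (v, e, f')" by (simp add: \<Psi>)
    qed
  qed
qed

lemma adj_flag_in_flags: "\<Phi> \<in> flags P \<Longrightarrow> i \<le> 2 \<Longrightarrow> adj_flag P i \<Phi> \<in> flags P"
  unfolding adj_flag_def using theI'[OF ex1_adj_flag] by blast

lemma flag_elem_adj_flag:
  "\<Phi> \<in> flags P \<Longrightarrow> i \<le> 2 \<Longrightarrow> j \<le> 2 \<Longrightarrow> flag_elem j (adj_flag P i \<Phi>) \<noteq> flag_elem j \<Phi> \<longleftrightarrow> j = i"
  unfolding adj_flag_def using theI'[OF ex1_adj_flag] by blast

lemma adj_flag_eqI: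
  assumes "\<Phi> \<in> flags P" "i \<le> 2" "\<Psi> \<in> flags P"
    "\<And>j. j \<le> 2 \<Longrightarrow> flag_elem j \<Psi> \<noteq> flag_elem j \<Phi> \<longleftrightarrow> j = i"
  shows "adj_flag P i \<Phi> = \<Psi>"
  unfolding adj_flag_def by (rule the1_equality[OF ex1_adj_flag]) (use assms in auto)

lemma adj_flag_involution:
  assumes "\<Phi> \<in> flags P" "i \<le> 2"
  shows "adj_flag P i (adj_flag P i \<Phi>) = \<Phi>"
proof (rule adj_flag_eqI)
  fix j :: nat assume "j \<le> 2"
  then show "flag_elem j \<Phi> \<noteq> flag_elem j (adj_flag P i \<Phi>) \<longleftrightarrow> j = i"
    using flag_elem_adj_flag[OF assms] by metis
qed (use assms adj_flag_in_flags in auto)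

lemma adj_flag_0_eq:
  "(v, e, f) \<in> flags P \<Longrightarrow> (v', e, f) \<in> flags P \<Longrightarrow> v' \<noteq> v \<Longrightarrow> adj_flag P 0 (v, e, f) = (v', e, f)"
  by (rule adj_flag_eqI) auto

lemma adj_flag_1_eq:
  "(v, e, f) \<in> flags P \<Longrightarrow> (v, e', f) \<in> flags P \<Longrightarrow> e' \<noteq> e \<Longrightarrow> adj_flag P 1 (v, e, f) = (v, e', f)"
  by (rule adj_flag_eqI) auto

lemma adj_flag_2_eq:
  "(v, e, f) \<in> flags P \<Longrightarrow> (v, e, f') \<in> flags P \<Longrightarrow> f' \<noteq> f \<Longrightarrow> adj_flag P 2 (v, e, f) = (v, e, f')"
  by (rule adj_flag_eqI) auto

text \<open>The new vertex and the new face are both incident to \<open>e\<close>, hence to each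
  other, so the two changes are independent.\<close>

lemma adj_flag_0_2_commute:
  assumes "\<Phi> \<in> flags P"
  shows "adj_flag P 0 (adj_flag P 2 \<Phi>) = adj_flag P 2 (adj_flag P 0 \<Phi>)"
proof -
  obtain v e f where \<Phi>: "\<Phi> = (v, e, f)" by (cases \<Phi>)
  obtain v' where v': "(v', e, f) \<in> flags P" "v' \<noteq> v" using ex1_vertex assms \<Phi> by blast
  obtain f' where f': "(v, e, f') \<in> flags P" "f' \<noteq> f" using ex1_face assms \<Phi> by blast
  have "(v', e, f') \<in> flags P" using v' f' by (simp add: flags_iff)
  with v' f' assms show ?thesis
    by (simp add: \<Phi> adj_flag_0_eq[of v e f v'] adj_flag_2_eq[of v e f f'] adj_flag_0_eq adj_flag_2_eq)
qed

text \<open>Local connectedness at \<open>v\<close> carries membership in \<open>S\<close> along the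
  edges and faces around \<open>v\<close>.\<close>

lemma flags_at_vertex_connected:
  assumes S: "\<And>\<Psi>. \<Psi> \<in> S \<Longrightarrow> \<Psi> \<in> flags P \<Longrightarrow> adj_flag P 1 \<Psi> \<in> S \<and> adj_flag P 2 \<Psi> \<in> S"
    and \<Phi>: "(v, e, f) \<in> S" "(v, e, f) \<in> flags P" and \<Psi>: "(v, e', f') \<in> flags P"
  shows "(v, e', f') \<in> S"
proof -
  \<comment> \<open>One predicate serves edges and faces: for an \<open>x\<close> of one kind the
    conjunct for the other kind is vacuous.\<close>
  define Q where "Q x \<longleftrightarrow> (\<forall>f. (v, x, f) \<in> flags P \<longrightarrow> (v, x, f) \<in> S) \<and>
    (\<forall>e. (v, e, x) \<in> flags P \<longrightarrow> (v, e, x) \<in> S)" for x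
  have Q_edge: "Q e" if "(v, e, f) \<in> S" "(v, e, f) \<in> flags P" for e f
    unfolding Q_def
  proof (intro conjI allI impI)
    fix f' assume "(v, e, f') \<in> flags P"
    then show "(v, e, f') \<in> S"
      using S[OF that] adj_flag_2_eq[of v e f f'] that by (cases "f' = f") auto
  qed (use that rank_disjoint in \<open>auto simp: flags_iff\<close>)
  have Q_face: "Q f" if "(v, e, f) \<in> S" "(v, e, f) \<in> flags P" for e f
    unfolding Q_def
  proof (intro conjI allI impI)
    fix e' assume "(v, e', f) \<in> flags P"
    then show "(v, e', f) \<in> S"
      using S[OF that] adj_flag_1_eq[of v e f e'] that by (cases "e' = e") auto
  qed (use that rank_disjoint in \<open>auto simp: flags_iff\<close>)
  have "Q e'"
  proof (rule incidence_connected_induct[where P = P and S = "neighbours P v" and x = e])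
    show "incidence_connected P (neighbours P v)"
      using \<Phi> by (intro locally_connected) (auto simp: flags_iff)
    show "e \<in> neighbours P v" "e' \<in> neighbours P v"
      using \<Phi> \<Psi> by (auto simp: neighbours_def flags_def elems_of_rank_def)
    show "Q e" using Q_edge \<Phi> .
    fix x y assume xy: "x \<in> neighbours P v" "y \<in> neighbours P v" "incident P x y" and "Q x"
    have v: "v \<in> vertices P" using \<Phi> by (simp add: flags_iff)
    have nb: "z \<in> edges P \<or> z \<in> faces P" if "z \<in> neighbours P v" for z
      using that v incident_same_rank[of v z]
      by (auto simp: neighbours_def elems_of_rank_def dest: rank_range)
    show "Q y"
    proof (cases "x = y")
      case False
      then have "rk P x \<noteq> rk P y" using xy(3) incident_same_rank by blast
      then consider "x \<in> edges P" "y \<in> faces P" | "x \<in> faces P" "y \<in> edges P"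
        using nb[OF xy(1)] nb[OF xy(2)] by (auto simp: elems_of_rank_def)
      then show ?thesis
      proof cases
        case 1
        then have "(v, x, y) \<in> flags P"
          using xy v by (auto simp: flags_def neighbours_def)
        with \<open>Q x\<close> show ?thesis by (intro Q_face) (auto simp: Q_def)
      next
        case 2
        then have "(v, y, x) \<in> flags P"
          using xy v incident_commute by (auto simp: flags_def neighbours_def)
        with \<open>Q x\<close> show ?thesis by (intro Q_edge) (auto simp: Q_def)
      qed
    qed (use \<open>Q x\<close> in simp)
  qed
  with \<Psi> show ?thesis by (simp add: Q_def)
qed

text \<open>Dual to \<open>flags_at_vertex_connected\<close>, with vertices and faces
  exchanged.\<close>

lemma flags_at_face_connected:
  assumes S: "\<And>\<Psi>. \<Psi> \<in> S \<Longrightarrow> \<Psi> \<in> flags P \<Longrightarrow> adj_flag P 0 \<Psi> \<in> S \<and> adj_flag P 1 \<Psi> \<in> S"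
    and \<Phi>: "(v, e, f) \<in> S" "(v, e, f) \<in> flags P" and \<Psi>: "(v', e', f) \<in> flags P"
  shows "(v', e', f) \<in> S"
proof -
  define Q where "Q x \<longleftrightarrow> (\<forall>v. (v, x, f) \<in> flags P \<longrightarrow> (v, x, f) \<in> S) \<and>
    (\<forall>e. (x, e, f) \<in> flags P \<longrightarrow> (x, e, f) \<in> S)" for x
  have Q_edge: "Q e" if "(v, e, f) \<in> S" "(v, e, f) \<in> flags P" for e v
    unfolding Q_def
  proof (intro conjI allI impI)
    fix v' assume "(v', e, f) \<in> flags P"
    then show "(v', e, f) \<in> S"
      using S[OF that] adj_flag_0_eq[of v e f v'] that by (cases "v' = v") auto
  qed (use that rank_disjoint in \<open>auto simp: flags_iff\<close>)
  have Q_vertex: "Q v" if "(v, e, f) \<in> S" "(v, e, f) \<in> flags P" for e v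
    unfolding Q_def
  proof (intro conjI allI impI)
    fix e' assume "(v, e', f) \<in> flags P"
    then show "(v, e', f) \<in> S"
      using S[OF that] adj_flag_1_eq[of v e f e'] that by (cases "e' = e") auto
  qed (use that rank_disjoint in \<open>auto simp: flags_iff\<close>)
  have "Q e'"
  proof (rule incidence_connected_induct[where P = P and S = "neighbours P f" and x = e])
    show "incidence_connected P (neighbours P f)"
      using \<Phi> by (intro locally_connected) (auto simp: flags_iff)
    show "e \<in> neighbours P f" "e' \<in> neighbours P f"
      using \<Phi> \<Psi> incident_commute by (auto simp: neighbours_def flags_def elems_of_rank_def)
    show "Q e" using Q_edge \<Phi> .
    fix x y assume xy: "x \<in> neighbours P f" "y \<in> neighbours P f" "incident P x y" and "Q x"
    have f: "f \<in> faces P" using \<Phi> by (simp add: flags_iff)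
    have nb: "z \<in> edges P \<or> z \<in> vertices P" if "z \<in> neighbours P f" for z
      using that f incident_same_rank[of f z]
      by (auto simp: neighbours_def elems_of_rank_def dest: rank_range)
    show "Q y"
    proof (cases "x = y")
      case False
      then have "rk P x \<noteq> rk P y" using xy(3) incident_same_rank by blast
      then consider "x \<in> edges P" "y \<in> vertices P" | "x \<in> vertices P" "y \<in> edges P"
        using nb[OF xy(1)] nb[OF xy(2)] by (auto simp: elems_of_rank_def)
      then show ?thesis
      proof cases
        case 1
        then have "(y, x, f) \<in> flags P"
          using xy f incident_commute by (auto simp: flags_def neighbours_def)
        with \<open>Q x\<close> show ?thesis by (intro Q_vertex) (auto simp: Q_def)
      next
        case 2
        then have "(x, y, f) \<in> flags P"
          using xy f incident_commute by (auto simp: flags_def neighbours_def)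
        with \<open>Q x\<close> show ?thesis by (intro Q_edge) (auto simp: Q_def)
      qed
    qed (use \<open>Q x\<close> in simp)
  qed
  with \<Psi> show ?thesis by (simp add: Q_def)
qed

definition flag_set :: "'a flag \<Rightarrow> 'a set" where
  "flag_set \<Phi> = (case \<Phi> of (v, e, f) \<Rightarrow> {v, e, f})"

lemma flag_set_simp [simp]: "flag_set (v, e, f) = {v, e, f}"
  by (simp add: flag_set_def)

text \<open>The missing element exists because each of the sets counted in the polyhedron axioms has
  two elements and so is not empty.\<close>

lemma flag_containing_incident:
  assumes "x \<in> elems P" "y \<in> elems P" "incident P x y" "x \<noteq> y"
  shows "\<exists>\<Phi>\<in>flags P. x \<in> flag_set \<Phi> \<and> y \<in> flag_set \<Phi>"
proof -
  have lt: "\<exists>\<Phi>\<in>flags P. x \<in> flag_set \<Phi> \<and> y \<in> flag_set \<Phi>"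
    if xy: "x \<in> elems P" "y \<in> elems P" "incident P x y" "rk P x < rk P y" for x y
  proof -
    have le: "(x, y) \<in> ord P" using xy incident_iff_ord by blast
    consider "x \<in> vertices P" "y \<in> edges P" | "x \<in> vertices P" "y \<in> faces P" | "x \<in> edges P" "y \<in> faces P"
      using rank_range[OF xy(1)] rank_range[OF xy(2)] xy by (auto simp: elems_of_rank_def)
    then show ?thesis
    proof cases
      case 1
      then obtain f where "f \<in> faces P" "incident P y f"
        using edge_faces[of y] by (metis (no_types, lifting) card.empty empty_Collect_eq zero_neq_numeral)
      with 1 le have "(x, y, f) \<in> flags P"
        by (auto simp: flags_iff elems_of_rank_def incident_iff_ord)
      then show ?thesis by force
    next
      case 2
      then obtain e where "e \<in> edges P" "incident P x e" "incident P e y"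
        using diamond[of x y] xy(3) by (metis (no_types, lifting) card.empty empty_Collect_eq zero_neq_numeral)
      with 2 xy have "(x, e, y) \<in> flags P" by (auto simp: flags_def)
      then show ?thesis by force
    next
      case 3
      then obtain v where "v \<in> vertices P" "incident P v x"
        using edge_vertices[of x] by (metis (no_types, lifting) card.empty empty_Collect_eq zero_neq_numeral)
      with 3 le have "(v, x, y) \<in> flags P"
        by (auto simp: flags_iff elems_of_rank_def incident_iff_ord)
      then show ?thesis by force
    qed
  qed
  have "rk P x < rk P y \<or> rk P y < rk P x"
    using assms incident_same_rank by (metis linorder_neqE_nat)
  then show ?thesis
    using lt[of x y] lt[of y x] assms incident_commute by blast
qed

text \<open>Along a path in the incidence graph consecutive distinct elements lie in a common flag,
  and flags sharing an element belong to \<open>S\<close> together.\<close>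

lemma flags_connected:
  assumes S: "\<And>\<Psi> i. \<Psi> \<in> S \<Longrightarrow> \<Psi> \<in> flags P \<Longrightarrow> i \<le> 2 \<Longrightarrow> adj_flag P i \<Psi> \<in> S"
    and \<Phi>: "\<Phi> \<in> S" "\<Phi> \<in> flags P" and "x \<in> elems P"
  shows "\<exists>\<Psi>\<in>S \<inter> flags P. x \<in> flag_set \<Psi>"
proof -
  define Q where "Q x \<longleftrightarrow> (\<exists>\<Psi>\<in>S \<inter> flags P. x \<in> flag_set \<Psi>)" for x
  have local: "\<Psi>' \<in> S"
    if \<Psi>: "\<Psi> \<in> S" "\<Psi> \<in> flags P" "\<Psi>' \<in> flags P" "x \<in> flag_set \<Psi>" "x \<in> flag_set \<Psi>'" for \<Psi> \<Psi>' x
  proof -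
    obtain v e f where 1: "\<Psi> = (v, e, f)" by (cases \<Psi>)
    obtain v' e' f' where 2: "\<Psi>' = (v', e', f')" by (cases \<Psi>')
    \<comment> \<open>Elements of different ranks are distinct, so the shared element has the same
      position in both flags.\<close>
    have "v = v' \<or> e = e' \<or> f = f'"
      using \<Psi> rank_disjoint by (auto simp: 1 2 flags_iff)
    then show ?thesis
    proof (elim disjE)
      assume "v = v'"
      then show ?thesis
        using flags_at_vertex_connected[of S v e f e' f'] S[of _ 1] S[of _ 2] \<Psi> by (simp add: 1 2)
    next
      assume "f = f'"
      then show ?thesis
        using flags_at_face_connected[of S v e f v' e'] S[of _ 1] S[of _ 0] \<Psi> by (simp add: 1 2)
    next
      \<comment> \<open>With a common edge it suffices to change first the face and then the
        vertex.\<close>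
      assume e: "e = e'"
      have mid: "(v, e, f') \<in> flags P" using \<Psi> e by (auto simp: 1 2 flags_iff)
      have "(v, e, f') \<in> S"
        using adj_flag_2_eq[of v e f f'] mid \<Psi> S[of \<Psi> 2] by (cases "f' = f") (auto simp: 1)
      then show ?thesis
        using adj_flag_0_eq[of v e f' v'] mid \<Psi> e S[of "(v, e, f')" 0] by (cases "v' = v") (auto simp: 2)
    qed
  qed
  obtain v e f where vef: "\<Phi> = (v, e, f)" by (cases \<Phi>)
  have "Q x"
  proof (rule incidence_connected_induct[OF connected, of v])
    show "v \<in> elems P" using \<Phi> by (simp add: vef flags_iff elems_of_rank_def)
    show "x \<in> elems P" by fact
    show "Q v" unfolding Q_def using \<Phi> by (intro bexI[of _ \<Phi>]) (auto simp: vef)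
    fix x y assume xy: "x \<in> elems P" "y \<in> elems P" "incident P x y" "Q x"
    show "Q y"
    proof (cases "x = y")
      case False
      obtain \<Psi> where "\<Psi> \<in> S" "\<Psi> \<in> flags P" "x \<in> flag_set \<Psi>" using xy(4) by (auto simp: Q_def)
      moreover obtain \<Psi>' where "\<Psi>' \<in> flags P" "x \<in> flag_set \<Psi>'" "y \<in> flag_set \<Psi>'"
        using flag_containing_incident[OF xy(1,2,3) False] by blast
      ultimately show ?thesis using local unfolding Q_def by blast
    qed (use xy in simp)
  qed
  then show ?thesis by (simp add: Q_def)
qed

section \<open>The automorphism group and its action on flags\<close>

abbreviation "\<Gamma> \<equiv> aut_group P"

lemma aut_group_carrier:
  "h \<in> carrier \<Gamma> \<longleftrightarrow> h \<in> Bij (elems P) \<and>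
     (\<forall>x\<in>elems P. \<forall>y\<in>elems P. (h x, h y) \<in> ord P \<longleftrightarrow> (x, y) \<in> ord P) \<and>
     (\<forall>x\<in>elems P. rk P (h x) = rk P x)"
  by (auto simp: aut_group_def)

lemma aut_closed: "h \<in> carrier \<Gamma> \<Longrightarrow> x \<in> elems P \<Longrightarrow> h x \<in> elems P"
  by (auto simp: aut_group_carrier dest: Bij_imp_funcset)

lemma subgroup_aut: "subgroup (carrier \<Gamma>) (BijGroup (elems P))"
proof (rule group.subgroupI[OF group_BijGroup])
  show "carrier \<Gamma> \<subseteq> carrier (BijGroup (elems P))"
    by (auto simp: aut_group_carrier BijGroup_def)
  have "(\<lambda>x\<in>elems P. x) \<in> carrier \<Gamma>" by (simp add: aut_group_carrier id_Bij)
  then show "carrier \<Gamma> \<noteq> {}" by blast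
next
  fix h assume h: "h \<in> carrier \<Gamma>"
  then have bij: "h \<in> Bij (elems P)" by (simp add: aut_group_carrier)
  let ?g = "\<lambda>x\<in>elems P. inv_into (elems P) h x"
  have g: "?g x \<in> elems P" "h (?g x) = x" if "x \<in> elems P" for x
    using that bij Bij_inv_into_mem[OF bij that]
    by (auto simp: Bij_def bij_betw_def f_inv_into_f)
  have "?g \<in> carrier \<Gamma>"
    unfolding aut_group_carrier
  proof (intro conjI ballI)
    show "?g \<in> Bij (elems P)" using bij by (rule restrict_inv_into_Bij)
    fix x assume x: "x \<in> elems P"
    show "rk P (?g x) = rk P x" using h g[OF x] by (metis aut_group_carrier)
    fix y assume y: "y \<in> elems P"
    show "(?g x, ?g y) \<in> ord P \<longleftrightarrow> (x, y) \<in> ord P"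
      using h g[OF x] g[OF y] by (metis aut_group_carrier)
  qed
  then show "inv\<^bsub>BijGroup (elems P)\<^esub> h \<in> carrier \<Gamma>"
    using inv_BijGroup[OF bij] by simp
next
  fix h k assume hk: "h \<in> carrier \<Gamma>" "k \<in> carrier \<Gamma>"
  then have "h \<otimes>\<^bsub>BijGroup (elems P)\<^esub> k = compose (elems P) h k"
    by (simp add: BijGroup_def aut_group_carrier)
  moreover have "compose (elems P) h k \<in> carrier \<Gamma>"
    using hk aut_closed[OF hk(2)] unfolding aut_group_carrier
    by (auto simp: compose_Bij compose_eq)
  ultimately show "h \<otimes>\<^bsub>BijGroup (elems P)\<^esub> k \<in> carrier \<Gamma>" by simp
qed

lemma group_aut: "group \<Gamma>"
proof -
  have "\<Gamma> = (BijGroup (elems P))\<lparr>carrier := carrier \<Gamma>\<rparr>" by (simp add: aut_group_def)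
  then show ?thesis using subgroup.subgroup_is_group[OF subgroup_aut group_BijGroup] by simp
qed

sublocale aut: group \<Gamma> by (rule group_aut)

lemma aut_mult_apply:
  "h \<in> carrier \<Gamma> \<Longrightarrow> k \<in> carrier \<Gamma> \<Longrightarrow> x \<in> elems P \<Longrightarrow> (h \<otimes>\<^bsub>\<Gamma>\<^esub> k) x = h (k x)"
  by (simp add: aut_group_def BijGroup_def compose_eq)

lemma aut_one_apply: "x \<in> elems P \<Longrightarrow> \<one>\<^bsub>\<Gamma>\<^esub> x = x"
  by (simp add: aut_group_def BijGroup_def)

text \<open>Members of \<open>Bij\<close> are extensional, so they agree outside
  \<open>elems P\<close> by convention.\<close>

lemma aut_eqI:
  assumes "h \<in> carrier \<Gamma>" "k \<in> carrier \<Gamma>" "\<And>x. x \<in> elems P \<Longrightarrow> h x = k x"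
  shows "h = k"
  using assms by (intro extensionalityI[of _ "elems P"]) (auto simp: aut_group_carrier Bij_def)

lemma flag_map_simp [simp]: "flag_map h (v, e, f) = (h v, h e, h f)"
  by (simp add: flag_map_def)

lemma flag_elem_flag_map: "flag_elem j (flag_map h \<Phi>) = h (flag_elem j \<Phi>)"
  by (cases \<Phi>) simp

lemma flag_elem_in_elems: "\<Phi> \<in> flags P \<Longrightarrow> flag_elem j \<Phi> \<in> elems P"
  by (cases \<Phi>) (auto simp: flags_iff elems_of_rank_def)

lemma aut_inj: "h \<in> carrier \<Gamma> \<Longrightarrow> x \<in> elems P \<Longrightarrow> y \<in> elems P \<Longrightarrow> h x = h y \<longleftrightarrow> x = y"
  by (auto simp: aut_group_carrier Bij_def bij_betw_def inj_on_def)

lemma flag_map_in_flags: "h \<in> carrier \<Gamma> \<Longrightarrow> \<Phi> \<in> flags P \<Longrightarrow> flag_map h \<Phi> \<in> flags P"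
  using aut_closed[of h] by (cases \<Phi>) (auto simp: flags_iff elems_of_rank_def aut_group_carrier)

lemma flag_map_mult:
  "h \<in> carrier \<Gamma> \<Longrightarrow> k \<in> carrier \<Gamma> \<Longrightarrow> \<Phi> \<in> flags P \<Longrightarrow>
    flag_map (h \<otimes>\<^bsub>\<Gamma>\<^esub> k) \<Phi> = flag_map h (flag_map k \<Phi>)"
  by (cases \<Phi>) (auto simp: flags_iff elems_of_rank_def aut_mult_apply)

lemma flag_map_one: "\<Phi> \<in> flags P \<Longrightarrow> flag_map \<one>\<^bsub>\<Gamma>\<^esub> \<Phi> = \<Phi>"
  by (cases \<Phi>) (auto simp: flags_iff elems_of_rank_def aut_one_apply)

text \<open>An automorphism is injective and hence preserves the ranks in which two flags
  differ.\<close>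

lemma flag_map_adj:
  assumes "h \<in> carrier \<Gamma>" "\<Phi> \<in> flags P" "i \<le> 2"
  shows "flag_map h (adj_flag P i \<Phi>) = adj_flag P i (flag_map h \<Phi>)"
  using assms
  by (intro adj_flag_eqI[symmetric])
    (auto simp: flag_map_in_flags adj_flag_in_flags flag_elem_flag_map aut_inj flag_elem_in_elems
      flag_elem_adj_flag)

lemma flag_map_inv:
  assumes "h \<in> carrier \<Gamma>" "\<Phi> \<in> flags P" "flag_map h \<Phi> = \<Psi>"
  shows "flag_map (inv\<^bsub>\<Gamma>\<^esub> h) \<Psi> = \<Phi>"
  using assms flag_map_mult[of "inv\<^bsub>\<Gamma>\<^esub> h" h \<Phi>] by (simp add: flag_map_one)

text \<open>The flags fixed by \<open>h\<close> are closed under adjacency, so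
  \<open>flags_connected\<close> puts every element into a fixed flag.\<close>

lemma fixes_flag_imp_one:
  assumes h: "h \<in> carrier \<Gamma>" and \<Phi>: "\<Phi> \<in> flags P" "flag_map h \<Phi> = \<Phi>"
  shows "h = \<one>\<^bsub>\<Gamma>\<^esub>"
proof (rule aut_eqI)
  fix x assume "x \<in> elems P"
  then have "\<exists>\<Psi>\<in>{\<Psi>. flag_map h \<Psi> = \<Psi>} \<inter> flags P. x \<in> flag_set \<Psi>"
    using \<Phi> h by (intro flags_connected[of _ \<Phi>]) (auto simp: flag_map_adj)
  then have "h x = x" by (auto simp: flag_set_def)
  then show "h x = \<one>\<^bsub>\<Gamma>\<^esub> x" using \<open>x \<in> elems P\<close> by (simp add: aut_one_apply)
qed (use h in auto)

lemma flag_map_inj: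
  assumes "h \<in> carrier \<Gamma>" "k \<in> carrier \<Gamma>" "\<Phi> \<in> flags P" "flag_map h \<Phi> = flag_map k \<Phi>"
  shows "h = k"
proof -
  have "flag_map (inv\<^bsub>\<Gamma>\<^esub> k \<otimes>\<^bsub>\<Gamma>\<^esub> h) \<Phi> = \<Phi>"
    using assms flag_map_inv[of k \<Phi>] by (simp add: flag_map_mult)
  then have "inv\<^bsub>\<Gamma>\<^esub> k \<otimes>\<^bsub>\<Gamma>\<^esub> h = \<one>\<^bsub>\<Gamma>\<^esub>"
    using assms by (intro fixes_flag_imp_one) auto
  then show ?thesis
    using assms by (metis aut.inv_closed aut.inv_equality aut.inv_inv)
qed

lemma stabilizer_subgroup:
  assumes "x \<in> elems P"
  shows "subgroup {h \<in> carrier \<Gamma>. h x = x} \<Gamma>"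
proof (rule aut.subgroupI)
  show "{h \<in> carrier \<Gamma>. h x = x} \<noteq> {}" using assms aut_one_apply by blast
next
  fix h assume h: "h \<in> {h \<in> carrier \<Gamma>. h x = x}"
  then have "(inv\<^bsub>\<Gamma>\<^esub> h \<otimes>\<^bsub>\<Gamma>\<^esub> h) x = (inv\<^bsub>\<Gamma>\<^esub> h) (h x)"
    using assms by (intro aut_mult_apply) auto
  with h assms show "inv\<^bsub>\<Gamma>\<^esub> h \<in> {h \<in> carrier \<Gamma>. h x = x}"
    by (simp add: aut_one_apply)
qed (use assms in \<open>auto simp: aut_mult_apply\<close>)

text \<open>This gives symmetric access to whichever class contains the flag. Invariance under
  automorphisms comes from the failure of transitivity on all flags.\<close>

lemma chiral_classE:
  assumes "chiral P" "\<Phi> \<in> flags P"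
  obtains C where "\<Phi> \<in> C" "C \<subseteq> flags P"
    "\<And>\<Psi> i. \<Psi> \<in> flags P \<Longrightarrow> i \<le> 2 \<Longrightarrow> adj_flag P i \<Psi> \<in> C \<longleftrightarrow> \<Psi> \<notin> C"
    "transitive_on_flags P C"
    "\<And>h \<Psi>. h \<in> carrier \<Gamma> \<Longrightarrow> \<Psi> \<in> C \<Longrightarrow> flag_map h \<Psi> \<in> C"
proof -
  obtain A B where part: "A \<noteq> B" "partition_on (flags P) {A, B}"
    and adj: "\<And>\<Psi> i. \<Psi> \<in> flags P \<Longrightarrow> i \<le> 2 \<Longrightarrow> \<Psi> \<in> A \<longleftrightarrow> adj_flag P i \<Psi> \<in> B"
    and trans: "transitive_on_flags P A" "transitive_on_flags P B"
    and not_trans: "\<not> transitive_on_flags P (flags P)"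
    using assms(1) unfolding chiral_def by blast
  have AB: "A \<union> B = flags P" "A \<inter> B = {}"
    using part by (auto simp: partition_on_def disjoint_def)
  have closed: "flag_map h \<Psi> \<in> C"
    if C: "C \<union> D = flags P" "C \<inter> D = {}" "transitive_on_flags P C" "transitive_on_flags P D"
      and h: "h \<in> carrier \<Gamma>" and \<Psi>: "\<Psi> \<in> C" for C D h \<Psi>
  proof (rule ccontr)
    assume "flag_map h \<Psi> \<notin> C"
    moreover have "flag_map h \<Psi> \<in> flags P" using C(1) h \<Psi> by (intro flag_map_in_flags) auto
    ultimately have D: "flag_map h \<Psi> \<in> D" using C(1) by blast
    have to: "\<exists>k\<in>carrier \<Gamma>. flag_map k \<Psi> = X" if "X \<in> flags P" for X
    proof (cases "X \<in> C")
      case True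
      with C(3) \<Psi> show ?thesis unfolding transitive_on_flags_def by blast
    next
      case False
      then have "X \<in> D" using C(1) that by blast
      then obtain k where k: "k \<in> carrier \<Gamma>" "flag_map k (flag_map h \<Psi>) = X"
        using C(4) D unfolding transitive_on_flags_def by metis
      then have "flag_map (k \<otimes>\<^bsub>\<Gamma>\<^esub> h) \<Psi> = X"
        using h \<Psi> C(1) by (subst flag_map_mult) auto
      then show ?thesis using k h by blast
    qed
    have "transitive_on_flags P (flags P)"
      unfolding transitive_on_flags_def
    proof (intro ballI)
      fix X Y assume XY: "X \<in> flags P" "Y \<in> flags P"
      obtain k where k: "k \<in> carrier \<Gamma>" "flag_map k \<Psi> = X" using to XY by blast
      obtain l where l: "l \<in> carrier \<Gamma>" "flag_map l \<Psi> = Y" using to XY by blast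
      have "flag_map (inv\<^bsub>\<Gamma>\<^esub> k) X = \<Psi>" using k \<Psi> C(1) by (intro flag_map_inv) auto
      then have "flag_map (l \<otimes>\<^bsub>\<Gamma>\<^esub> inv\<^bsub>\<Gamma>\<^esub> k) X = Y"
        using k l XY by (subst flag_map_mult) auto
      then show "\<exists>h\<in>carrier \<Gamma>. flag_map h X = Y" using k l by blast
    qed
    with not_trans show False ..
  qed
  show thesis
  proof (cases "\<Phi> \<in> A")
    case True
    show ?thesis
    proof (rule that[of A])
      show "adj_flag P i \<Psi> \<in> A \<longleftrightarrow> \<Psi> \<notin> A" if "\<Psi> \<in> flags P" "i \<le> 2" for \<Psi> i
        using adj[OF that] adj_flag_in_flags[OF that] AB by blast
      show "flag_map h \<Psi> \<in> A" if "h \<in> carrier \<Gamma>" "\<Psi> \<in> A" for h \<Psi>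
        using closed[OF AB trans that] .
    qed (use True AB trans in auto)
  next
    case False
    show ?thesis
    proof (rule that[of B])
      show "adj_flag P i \<Psi> \<in> B \<longleftrightarrow> \<Psi> \<notin> B" if "\<Psi> \<in> flags P" "i \<le> 2" for \<Psi> i
        using adj[OF that] adj_flag_in_flags[OF that] AB that by blast
      show "flag_map h \<Psi> \<in> B" if "h \<in> carrier \<Gamma>" "\<Psi> \<in> B" for h \<Psi>
        using closed[OF _ _ trans(2,1) that] AB by (simp add: Un_commute Int_commute)
    qed (use False assms(2) AB trans in auto)
  qed
qed

end

section \<open>The rotation group of a tight chiral polyhedron\<close>

locale chiral_class = polyhedron P for P :: "'a ranked_poset" +
  fixes C :: "'a flag set" and \<Phi> :: "'a flag"
  assumes base: "\<Phi> \<in> C"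
    and class_flags: "C \<subseteq> flags P"
    and class_adj: "\<Psi> \<in> flags P \<Longrightarrow> i \<le> 2 \<Longrightarrow> adj_flag P i \<Psi> \<in> C \<longleftrightarrow> \<Psi> \<notin> C"
    and class_trans: "transitive_on_flags P C"
    and class_invariant: "h \<in> carrier (aut_group P) \<Longrightarrow> \<Psi> \<in> C \<Longrightarrow> flag_map h \<Psi> \<in> C"
begin

lemma base_flag [simp]: "\<Phi> \<in> flags P"
  using base class_flags by blast

lemma adj_adj_in_class:
  assumes "i \<le> 2" "j \<le> 2"
  shows "adj_flag P i (adj_flag P j \<Phi>) \<in> C"
  using assms base by (simp add: class_adj adj_flag_in_flags)

text \<open>Existence is transitivity on the class and uniqueness is freeness; the definite
  descriptions of \<open>sigma1\<close> and \<open>sigma2\<close> rest on this.\<close>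

lemma ex1_aut:
  assumes "\<Psi> \<in> C"
  shows "\<exists>!h. h \<in> carrier \<Gamma> \<and> flag_map h \<Phi> = \<Psi>"
proof -
  obtain h where "h \<in> carrier \<Gamma>" "flag_map h \<Phi> = \<Psi>"
    using class_trans base assms unfolding transitive_on_flags_def by blast
  then show ?thesis using flag_map_inj[OF _ _ base_flag] by metis
qed

abbreviation "\<sigma>\<^sub>1 \<equiv> sigma1 P \<Phi>"
abbreviation "\<sigma>\<^sub>2 \<equiv> sigma2 P \<Phi>"

lemma sigma1: "\<sigma>\<^sub>1 \<in> carrier \<Gamma>" "flag_map \<sigma>\<^sub>1 \<Phi> = adj_flag P 0 (adj_flag P 1 \<Phi>)"
  using theI'[OF ex1_aut[OF adj_adj_in_class[of 0 1]]] by (auto simp: sigma1_def)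

lemma sigma2: "\<sigma>\<^sub>2 \<in> carrier \<Gamma>" "flag_map \<sigma>\<^sub>2 \<Phi> = adj_flag P 1 (adj_flag P 2 \<Phi>)"
  using theI'[OF ex1_aut[OF adj_adj_in_class[of 1 2]]] by (auto simp: sigma2_def)

text \<open>\<open>adj_flag P 0\<close> maps \<open>C\<close> bijectively onto the other
  class.\<close>

lemma card_class: "finite (flags P) \<Longrightarrow> card (flags P) = 2 * card C"
proof -
  assume fin: "finite (flags P)"
  have inj: "inj_on (adj_flag P 0) C"
    by (rule inj_on_inverseI[where g = "adj_flag P 0"])
      (use class_flags in \<open>auto intro!: adj_flag_involution\<close>)
  have "flags P = C \<union> adj_flag P 0 ` C"
  proof (intro equalityI subsetI)
    fix \<Psi> assume \<Psi>: "\<Psi> \<in> flags P"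
    show "\<Psi> \<in> C \<union> adj_flag P 0 ` C"
    proof (cases "\<Psi> \<in> C")
      case False
      then have "adj_flag P 0 \<Psi> \<in> C" using class_adj \<Psi> by simp
      moreover have "\<Psi> = adj_flag P 0 (adj_flag P 0 \<Psi>)" using adj_flag_involution \<Psi> by simp
      ultimately show ?thesis by blast
    qed simp
  qed (use class_flags adj_flag_in_flags in auto)
  moreover have "C \<inter> adj_flag P 0 ` C = {}"
    using class_adj class_flags by fastforce
  moreover have "finite C" using fin class_flags finite_subset by blast
  ultimately show ?thesis using card_image[OF inj] by (simp add: card_Un_disjoint)
qed

lemma bij_betw_aut_class: "bij_betw (\<lambda>h. flag_map h \<Phi>) (carrier \<Gamma>) C"
  unfolding bij_betw_def
proof
  show "inj_on (\<lambda>h. flag_map h \<Phi>) (carrier \<Gamma>)"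
    using flag_map_inj[OF _ _ base_flag] by (auto intro: inj_onI)
  show "(\<lambda>h. flag_map h \<Phi>) ` carrier \<Gamma> = C"
    using class_invariant base ex1_aut by blast
qed

text \<open>Take for \<open>S\<close> the orbits of \<open>\<Phi>\<close> and of its
  \<open>j\<close>-adjacent flag under \<open><\<sigma>>\<close>. Both adjacencies exchange these
  orbits, and the second orbit lies outside \<open>C\<close>. The uses are \<open>j = 1\<close>,
  \<open>k = 0\<close> for \<open>\<sigma>\<^sub>1\<close> and \<open>j = 2\<close>,
  \<open>k = 1\<close> for \<open>\<sigma>\<^sub>2\<close>.\<close>

lemma rotation_orbit:
  assumes \<sigma>: "\<sigma> \<in> carrier \<Gamma>" "flag_map \<sigma> \<Phi> = adj_flag P k (adj_flag P j \<Phi>)"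
    and jk: "j \<le> 2" "k \<le> 2"
  obtains S where "\<Phi> \<in> S"
    "\<And>\<Psi>. \<Psi> \<in> S \<Longrightarrow> adj_flag P j \<Psi> \<in> S \<and> adj_flag P k \<Psi> \<in> S"
    "S \<inter> C \<subseteq> (\<lambda>h. flag_map h \<Phi>) ` generate \<Gamma> {\<sigma>}"
proof -
  let ?H = "generate \<Gamma> {\<sigma>}"
  have H: "subgroup ?H \<Gamma>" using \<sigma> by (intro aut.generate_is_subgroup) auto
  have \<sigma>H: "\<sigma> \<in> ?H" by (intro generate.incl) auto
  have Hc: "h \<in> carrier \<Gamma>" if "h \<in> ?H" for h using subgroup.mem_carrier[OF H that] .
  let ?\<Psi> = "adj_flag P j \<Phi>"
  have \<Psi>: "?\<Psi> \<in> flags P" "adj_flag P j ?\<Psi> = \<Phi>"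
    using jk by (auto simp: adj_flag_in_flags adj_flag_involution)
  have "flag_map \<sigma> (adj_flag P k \<Phi>) = ?\<Psi>"
    using \<sigma> jk \<Psi>(1) by (simp add: flag_map_adj adj_flag_involution)
  then have k\<Phi>: "flag_map (inv\<^bsub>\<Gamma>\<^esub> \<sigma>) ?\<Psi> = adj_flag P k \<Phi>"
    using \<sigma> jk by (intro flag_map_inv) (auto simp: adj_flag_in_flags)
  define S where "S = (\<lambda>h. flag_map h \<Phi>) ` ?H \<union> (\<lambda>h. flag_map h ?\<Psi>) ` ?H"
  have S1: "adj_flag P j (flag_map h \<Phi>) \<in> S \<and> adj_flag P k (flag_map h \<Phi>) \<in> S" if h: "h \<in> ?H" for h
  proof
    show "adj_flag P j (flag_map h \<Phi>) \<in> S"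
      using h jk Hc by (auto simp: S_def flag_map_adj)
    have "adj_flag P k (flag_map h \<Phi>) = flag_map (h \<otimes>\<^bsub>\<Gamma>\<^esub> inv\<^bsub>\<Gamma>\<^esub> \<sigma>) ?\<Psi>"
      using Hc[OF h] \<sigma>(1) jk \<Psi>(1) k\<Phi> flag_map_adj[of h \<Phi> k] by (simp add: flag_map_mult)
    moreover have "h \<otimes>\<^bsub>\<Gamma>\<^esub> inv\<^bsub>\<Gamma>\<^esub> \<sigma> \<in> ?H"
      using H h \<sigma>H by (simp add: subgroup.m_closed subgroup.m_inv_closed)
    ultimately show "adj_flag P k (flag_map h \<Phi>) \<in> S" by (auto simp: S_def)
  qed
  have S2: "adj_flag P j (flag_map h ?\<Psi>) \<in> S \<and> adj_flag P k (flag_map h ?\<Psi>) \<in> S" if h: "h \<in> ?H" for h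
  proof
    have "adj_flag P j (flag_map h ?\<Psi>) = flag_map h \<Phi>"
      using Hc[OF h] jk \<Psi> by (metis flag_map_adj)
    then show "adj_flag P j (flag_map h ?\<Psi>) \<in> S" using h by (auto simp: S_def)
    have "adj_flag P k (flag_map h ?\<Psi>) = flag_map (h \<otimes>\<^bsub>\<Gamma>\<^esub> \<sigma>) \<Phi>"
      using Hc[OF h] \<sigma> jk \<Psi>(1) by (simp add: flag_map_mult flag_map_adj)
    moreover have "h \<otimes>\<^bsub>\<Gamma>\<^esub> \<sigma> \<in> ?H"
      using H h \<sigma>H by (simp add: subgroup.m_closed)
    ultimately show "adj_flag P k (flag_map h ?\<Psi>) \<in> S" by (auto simp: S_def)
  qed
  show thesis
  proof (rule that)
    have "\<one>\<^bsub>\<Gamma>\<^esub> \<in> ?H" by (rule generate.one)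
    then show "\<Phi> \<in> S" using flag_map_one[OF base_flag] unfolding S_def by force
    show "adj_flag P j \<Psi> \<in> S \<and> adj_flag P k \<Psi> \<in> S" if "\<Psi> \<in> S" for \<Psi>
      using that S1 S2 unfolding S_def by blast
    have "flag_map h ?\<Psi> \<notin> C" if "h \<in> ?H" for h
      using Hc[OF that] jk class_adj[of "flag_map h \<Phi>" j] class_invariant[OF Hc[OF that] base]
      by (simp add: flag_map_adj flag_map_in_flags)
    then show "S \<inter> C \<subseteq> (\<lambda>h. flag_map h \<Phi>) ` ?H" by (auto simp: S_def)
  qed
qed

section \<open>Orders and intersection of the two cyclic subgroups\<close>

lemma ord_eq_card_orbit:
  assumes "\<sigma> \<in> carrier \<Gamma>"
  shows "aut.ord \<sigma> = card ((\<lambda>h. flag_map h \<Phi>) ` generate \<Gamma> {\<sigma>})"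
proof -
  have "generate \<Gamma> {\<sigma>} \<subseteq> carrier \<Gamma>" using assms by (intro aut.generate_incl) auto
  then have "inj_on (\<lambda>h. flag_map h \<Phi>) (generate \<Gamma> {\<sigma>})"
    using bij_betw_aut_class by (meson bij_betw_def inj_on_subset)
  then show ?thesis using aut.generate_pow_card[OF assms] by (simp add: card_image)
qed

lemma generate_fixes:
  assumes "\<sigma> \<in> carrier \<Gamma>" "x \<in> elems P" "\<sigma> x = x" "h \<in> generate \<Gamma> {\<sigma>}"
  shows "h x = x"
  using aut.generate_subgroup_incl[OF _ stabilizer_subgroup[OF assms(2)], of "{\<sigma>}"] assms by auto

lemma sigma1_face: "\<sigma>\<^sub>1 (flag_elem 2 \<Phi>) = flag_elem 2 \<Phi>"
proof -
  have "flag_elem 2 (adj_flag P 0 (adj_flag P 1 \<Phi>)) = flag_elem 2 \<Phi>"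
    using flag_elem_adj_flag[of "adj_flag P 1 \<Phi>" 0 2] flag_elem_adj_flag[of \<Phi> 1 2]
    by (simp add: adj_flag_in_flags)
  then show ?thesis using sigma1(2) flag_elem_flag_map by metis
qed

lemma sigma2_vertex: "\<sigma>\<^sub>2 (flag_elem 0 \<Phi>) = flag_elem 0 \<Phi>"
proof -
  have "flag_elem 0 (adj_flag P 1 (adj_flag P 2 \<Phi>)) = flag_elem 0 \<Phi>"
    using flag_elem_adj_flag[of "adj_flag P 2 \<Phi>" 1 0] flag_elem_adj_flag[of \<Phi> 2 0]
    by (simp add: adj_flag_in_flags)
  then show ?thesis using sigma2(2) flag_elem_flag_map by metis
qed

text \<open>Powers of \<open>\<sigma>\<^sub>1\<close> fix \<open>f\<close>; conversely the set from
  \<open>rotation_orbit\<close> is closed under changing vertex and edge, so it contains all flags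
  at \<open>f\<close>.\<close>

lemma sigma1_orbit:
  assumes "\<Phi> = (v, e, f)"
  shows "(\<lambda>h. flag_map h \<Phi>) ` generate \<Gamma> {\<sigma>\<^sub>1} = {\<Psi> \<in> C. flag_elem 2 \<Psi> = f}"
proof (intro equalityI subsetI)
  fix \<Psi> assume "\<Psi> \<in> (\<lambda>h. flag_map h \<Phi>) ` generate \<Gamma> {\<sigma>\<^sub>1}"
  then obtain h where h: "h \<in> generate \<Gamma> {\<sigma>\<^sub>1}" "\<Psi> = flag_map h \<Phi>" by blast
  have "generate \<Gamma> {\<sigma>\<^sub>1} \<subseteq> carrier \<Gamma>" using sigma1(1) by (intro aut.generate_incl) auto
  then have "\<Psi> \<in> C" using h class_invariant base by blast
  moreover have "h (flag_elem 2 \<Phi>) = flag_elem 2 \<Phi>"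
    using generate_fixes[OF sigma1(1) _ sigma1_face h(1)] flag_elem_in_elems[OF base_flag] by blast
  ultimately show "\<Psi> \<in> {\<Psi> \<in> C. flag_elem 2 \<Psi> = f}"
    using assms by (simp add: h(2))
next
  fix \<Psi> assume \<Psi>: "\<Psi> \<in> {\<Psi> \<in> C. flag_elem 2 \<Psi> = f}"
  obtain S where S: "\<Phi> \<in> S" "\<And>\<Psi>. \<Psi> \<in> S \<Longrightarrow> adj_flag P 1 \<Psi> \<in> S \<and> adj_flag P 0 \<Psi> \<in> S"
    "S \<inter> C \<subseteq> (\<lambda>h. flag_map h \<Phi>) ` generate \<Gamma> {\<sigma>\<^sub>1}"
    using rotation_orbit[OF sigma1] by auto
  obtain v' e' where \<Psi>': "\<Psi> = (v', e', f)" using \<Psi> by (cases \<Psi>) auto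
  have "(v', e', f) \<in> S"
  proof (rule flags_at_face_connected[of S v e f])
    show "(v, e, f) \<in> S" "(v, e, f) \<in> flags P" using S(1) base_flag by (simp_all only: assms)
    show "(v', e', f) \<in> flags P" using \<Psi> \<Psi>' class_flags by auto
  qed (use S(2) in auto)
  then have "\<Psi> \<in> S \<inter> C" using \<Psi> \<Psi>' by simp
  then show "\<Psi> \<in> (\<lambda>h. flag_map h \<Phi>) ` generate \<Gamma> {\<sigma>\<^sub>1}"
    using S(3) by (rule subsetD[rotated])
qed

text \<open>Dual to \<open>sigma1_orbit\<close>, with the base vertex in place of the base
  face.\<close>

lemma sigma2_orbit:
  assumes "\<Phi> = (v, e, f)"
  shows "(\<lambda>h. flag_map h \<Phi>) ` generate \<Gamma> {\<sigma>\<^sub>2} = {\<Psi> \<in> C. flag_elem 0 \<Psi> = v}"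
proof (intro equalityI subsetI)
  fix \<Psi> assume "\<Psi> \<in> (\<lambda>h. flag_map h \<Phi>) ` generate \<Gamma> {\<sigma>\<^sub>2}"
  then obtain h where h: "h \<in> generate \<Gamma> {\<sigma>\<^sub>2}" "\<Psi> = flag_map h \<Phi>" by blast
  have "generate \<Gamma> {\<sigma>\<^sub>2} \<subseteq> carrier \<Gamma>" using sigma2(1) by (intro aut.generate_incl) auto
  then have "\<Psi> \<in> C" using h class_invariant base by blast
  moreover have "h (flag_elem 0 \<Phi>) = flag_elem 0 \<Phi>"
    using generate_fixes[OF sigma2(1) _ sigma2_vertex h(1)] flag_elem_in_elems[OF base_flag] by blast
  ultimately show "\<Psi> \<in> {\<Psi> \<in> C. flag_elem 0 \<Psi> = v}"
    using assms by (simp add: h(2))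
next
  fix \<Psi> assume \<Psi>: "\<Psi> \<in> {\<Psi> \<in> C. flag_elem 0 \<Psi> = v}"
  obtain S where S: "\<Phi> \<in> S" "\<And>\<Psi>. \<Psi> \<in> S \<Longrightarrow> adj_flag P 2 \<Psi> \<in> S \<and> adj_flag P 1 \<Psi> \<in> S"
    "S \<inter> C \<subseteq> (\<lambda>h. flag_map h \<Phi>) ` generate \<Gamma> {\<sigma>\<^sub>2}"
    using rotation_orbit[OF sigma2] by auto
  obtain e' f' where \<Psi>': "\<Psi> = (v, e', f')" using \<Psi> by (cases \<Psi>) auto
  have "(v, e', f') \<in> S"
  proof (rule flags_at_vertex_connected[of S v e f])
    show "(v, e, f) \<in> S" "(v, e, f) \<in> flags P" using S(1) base_flag by (simp_all only: assms)
    show "(v, e', f') \<in> flags P" using \<Psi> \<Psi>' class_flags by auto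
  qed (use S(2) in auto)
  then have "\<Psi> \<in> S \<inter> C" using \<Psi> \<Psi>' by simp
  then show "\<Psi> \<in> (\<lambda>h. flag_map h \<Phi>) ` generate \<Gamma> {\<sigma>\<^sub>2}"
    using S(3) by (rule subsetD[rotated])
qed

text \<open>Each edge of the base face lies in two flags with that face. They are
  \<open>0\<close>-adjacent, so exactly one is in \<open>C\<close>, and the orbit has as many flags
  as the face has edges.\<close>

lemma ord_sigma1:
  assumes "has_type P p q"
  shows "aut.ord \<sigma>\<^sub>1 = p"
proof -
  obtain v e f where \<Phi>: "\<Phi> = (v, e, f)" by (cases \<Phi>)
  have f: "f \<in> faces P" using base_flag by (simp only: \<Phi> flags_iff)
  have "bij_betw (flag_elem 1) {\<Psi> \<in> C. flag_elem 2 \<Psi> = f} {e \<in> edges P. incident P e f}"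
    unfolding bij_betw_def
  proof (intro conjI inj_onI equalityI subsetI)
    fix X Y assume XY: "X \<in> {\<Psi> \<in> C. flag_elem 2 \<Psi> = f}" "Y \<in> {\<Psi> \<in> C. flag_elem 2 \<Psi> = f}"
      "flag_elem 1 X = flag_elem 1 Y"
    obtain x d y where xy: "X = (x, d, f)" "Y = (y, d, f)" using XY by (cases X; cases Y) auto
    have fl: "(x, d, f) \<in> flags P" "(y, d, f) \<in> flags P" using XY xy class_flags by auto
    then show "X = Y"
      using adj_flag_0_eq[OF fl] class_adj[OF fl(1), of 0] XY xy by (cases "y = x") auto
  next
    fix d assume "d \<in> flag_elem 1 ` {\<Psi> \<in> C. flag_elem 2 \<Psi> = f}"
    then obtain x where "(x, d, f) \<in> C" by auto
    then show "d \<in> {e \<in> edges P. incident P e f}" using class_flags by (auto simp: flags_def)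
  next
    fix d assume d: "d \<in> {e \<in> edges P. incident P e f}"
    then have "d \<in> elems P" "f \<in> elems P" "incident P d f" "d \<noteq> f"
      using f by (auto simp: elems_of_rank_def)
    then obtain \<Psi> where "\<Psi> \<in> flags P" "d \<in> flag_set \<Psi>" "f \<in> flag_set \<Psi>"
      using flag_containing_incident by metis
    then obtain x where x: "(x, d, f) \<in> flags P"
      using d f rank_disjoint by (cases \<Psi>) (auto simp: flags_iff)
    obtain y where y: "adj_flag P 0 (x, d, f) = (y, d, f)"
      using ex1_vertex[OF x] adj_flag_0_eq[OF x] by blast
    have "(x, d, f) \<in> C \<or> (y, d, f) \<in> C" using class_adj[OF x, of 0] y by auto
    then show "d \<in> flag_elem 1 ` {\<Psi> \<in> C. flag_elem 2 \<Psi> = f}" by force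
  qed
  then have "card {\<Psi> \<in> C. flag_elem 2 \<Psi> = f} = p"
    using assms f bij_betw_same_card unfolding has_type_def by fastforce
  then show ?thesis using ord_eq_card_orbit[OF sigma1(1)] sigma1_orbit[OF \<Phi>] by simp
qed

text \<open>Dual to \<open>ord_sigma1\<close>: the two flags at the base vertex with a given edge
  are \<open>2\<close>-adjacent.\<close>

lemma ord_sigma2:
  assumes "has_type P p q"
  shows "aut.ord \<sigma>\<^sub>2 = q"
proof -
  obtain v e f where \<Phi>: "\<Phi> = (v, e, f)" by (cases \<Phi>)
  have v: "v \<in> vertices P" using base_flag by (simp only: \<Phi> flags_iff)
  have "bij_betw (flag_elem 1) {\<Psi> \<in> C. flag_elem 0 \<Psi> = v} {e \<in> edges P. incident P v e}"
    unfolding bij_betw_def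
  proof (intro conjI inj_onI equalityI subsetI)
    fix X Y assume XY: "X \<in> {\<Psi> \<in> C. flag_elem 0 \<Psi> = v}" "Y \<in> {\<Psi> \<in> C. flag_elem 0 \<Psi> = v}"
      "flag_elem 1 X = flag_elem 1 Y"
    obtain x d y where xy: "X = (v, d, x)" "Y = (v, d, y)" using XY by (cases X; cases Y) auto
    have fl: "(v, d, x) \<in> flags P" "(v, d, y) \<in> flags P" using XY xy class_flags by auto
    then show "X = Y"
      using adj_flag_2_eq[OF fl] class_adj[OF fl(1), of 2] XY xy by (cases "y = x") auto
  next
    fix d assume "d \<in> flag_elem 1 ` {\<Psi> \<in> C. flag_elem 0 \<Psi> = v}"
    then obtain x where "(v, d, x) \<in> C" by auto
    then show "d \<in> {e \<in> edges P. incident P v e}" using class_flags by (auto simp: flags_def)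
  next
    fix d assume d: "d \<in> {e \<in> edges P. incident P v e}"
    then have "v \<in> elems P" "d \<in> elems P" "incident P v d" "v \<noteq> d"
      using v by (auto simp: elems_of_rank_def)
    then obtain \<Psi> where "\<Psi> \<in> flags P" "v \<in> flag_set \<Psi>" "d \<in> flag_set \<Psi>"
      using flag_containing_incident by metis
    then obtain x where x: "(v, d, x) \<in> flags P"
      using d v rank_disjoint by (cases \<Psi>) (auto simp: flags_iff)
    obtain y where y: "adj_flag P 2 (v, d, x) = (v, d, y)"
      using ex1_face[OF x] adj_flag_2_eq[OF x] by blast
    have "(v, d, x) \<in> C \<or> (v, d, y) \<in> C" using class_adj[OF x, of 2] y by auto
    then show "d \<in> flag_elem 1 ` {\<Psi> \<in> C. flag_elem 0 \<Psi> = v}" by force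
  qed
  then have "card {\<Psi> \<in> C. flag_elem 0 \<Psi> = v} = q"
    using assms v bij_betw_same_card unfolding has_type_def by fastforce
  then show ?thesis using ord_eq_card_orbit[OF sigma2(1)] sigma2_orbit[OF \<Phi>] by simp
qed

text \<open>A common element fixes the base vertex and face, so it sends \<open>\<Phi>\<close> to
  itself or to its \<open>1\<close>-adjacent flag. The latter lies outside \<open>C\<close>.\<close>

lemma generate_disjoint:
  assumes "h \<in> generate \<Gamma> {\<sigma>\<^sub>1}" "h \<in> generate \<Gamma> {\<sigma>\<^sub>2}"
  shows "h = \<one>\<^bsub>\<Gamma>\<^esub>"
proof -
  obtain v e f where \<Phi>: "\<Phi> = (v, e, f)" by (cases \<Phi>)
  have el: "v \<in> elems P" "f \<in> elems P"
    using flag_elem_in_elems[OF base_flag, of 0] flag_elem_in_elems[OF base_flag, of 2] by (auto simp: \<Phi>)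
  have h: "h \<in> carrier \<Gamma>"
    using aut.generate_incl[of "{\<sigma>\<^sub>1}"] sigma1(1) assms(1) by auto
  have "h f = f" using generate_fixes[OF sigma1(1) el(2) _ assms(1)] sigma1_face \<Phi> by simp
  moreover have "h v = v" using generate_fixes[OF sigma2(1) el(1) _ assms(2)] sigma2_vertex \<Phi> by simp
  ultimately have map: "flag_map h \<Phi> = (v, h e, f)" by (simp add: \<Phi>)
  have fl: "(v, e, f) \<in> flags P" "(v, h e, f) \<in> flags P"
    using flag_map_in_flags[OF h base_flag] base_flag map \<Phi> by simp_all
  have "h e = e"
  proof (rule ccontr)
    assume "h e \<noteq> e"
    then have "adj_flag P 1 (v, e, f) = (v, h e, f)" by (rule adj_flag_1_eq[OF fl])
    then show False
      using class_adj[OF fl(1), of 1] class_invariant[OF h base] base map \<Phi> by simp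
  qed
  then show ?thesis using map \<Phi> fixes_flag_imp_one[OF h base_flag] by simp
qed

text \<open>The product is the half-turn about the edge of \<open>?\<Psi>\<close>: it sends
  \<open>?\<Psi>\<close> to the flag with both vertex and face changed, and these two changes
  commute.\<close>

lemma sigma_involution:
  shows "(\<sigma>\<^sub>1 \<otimes>\<^bsub>\<Gamma>\<^esub> \<sigma>\<^sub>2) \<otimes>\<^bsub>\<Gamma>\<^esub> (\<sigma>\<^sub>1 \<otimes>\<^bsub>\<Gamma>\<^esub> \<sigma>\<^sub>2) = \<one>\<^bsub>\<Gamma>\<^esub>" and "\<sigma>\<^sub>1 \<otimes>\<^bsub>\<Gamma>\<^esub> \<sigma>\<^sub>2 \<noteq> \<one>\<^bsub>\<Gamma>\<^esub>"
proof -
  let ?h = "\<sigma>\<^sub>1 \<otimes>\<^bsub>\<Gamma>\<^esub> \<sigma>\<^sub>2" and ?\<Psi> = "adj_flag P 1 \<Phi>"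
  note [simp] = sigma1(1) sigma2(1) adj_flag_in_flags
  have "flag_map ?h \<Phi> = adj_flag P 1 (adj_flag P 2 (adj_flag P 0 ?\<Psi>))"
    using sigma1(2) sigma2(2) by (simp add: flag_map_mult flag_map_adj)
  then have h\<Psi>: "flag_map ?h ?\<Psi> = adj_flag P 2 (adj_flag P 0 ?\<Psi>)"
    by (simp add: flag_map_adj adj_flag_involution)
  have "flag_map (?h \<otimes>\<^bsub>\<Gamma>\<^esub> ?h) ?\<Psi> = adj_flag P 2 (adj_flag P 0 (adj_flag P 2 (adj_flag P 0 ?\<Psi>)))"
  proof -
    have "flag_map (?h \<otimes>\<^bsub>\<Gamma>\<^esub> ?h) ?\<Psi> = flag_map ?h (adj_flag P 2 (adj_flag P 0 ?\<Psi>))"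
      using h\<Psi> flag_map_mult[of ?h ?h ?\<Psi>] by simp
    also have "\<dots> = adj_flag P 2 (adj_flag P 0 (flag_map ?h ?\<Psi>))"
      using flag_map_adj[of ?h "adj_flag P 0 ?\<Psi>" 2] flag_map_adj[of ?h ?\<Psi> 0] by simp
    finally show ?thesis by (simp only: h\<Psi>)
  qed
  also have "\<dots> = ?\<Psi>"
    by (simp add: adj_flag_0_2_commute adj_flag_involution)
  finally show "?h \<otimes>\<^bsub>\<Gamma>\<^esub> ?h = \<one>\<^bsub>\<Gamma>\<^esub>"
    by (intro fixes_flag_imp_one[of _ ?\<Psi>]) auto
  show "?h \<noteq> \<one>\<^bsub>\<Gamma>\<^esub>"
  proof
    assume "?h = \<one>\<^bsub>\<Gamma>\<^esub>"
    then have "adj_flag P 2 (adj_flag P 0 ?\<Psi>) = ?\<Psi>" using h\<Psi> by (simp add: flag_map_one)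
    then have "adj_flag P 0 ?\<Psi> = adj_flag P 2 ?\<Psi>"
      using adj_flag_involution[of "adj_flag P 0 ?\<Psi>" 2] by simp
    then show False
      using flag_elem_adj_flag[of ?\<Psi> 0 0] flag_elem_adj_flag[of ?\<Psi> 2 0] by simp
  qed
qed

text \<open>The action on \<open>C\<close> is regular, so tightness gives the group order
  \<open>p * q\<close>. The cyclic subgroups have orders \<open>p\<close> and \<open>q\<close> and
  meet trivially, so counting makes their product the whole group.\<close>

lemma cyclic_factorization_aut:
  assumes tight: "tight P p q" and "odd q"
  shows "cyclic_factorization \<Gamma> \<sigma>\<^sub>1 \<sigma>\<^sub>2" and "order \<Gamma> = p * q"
proof -
  have type: "has_type P p q" and fin: "finite (flags P)" and card: "card (flags P) = 2 * p * q"
    using tight by (auto simp: tight_def)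
  let ?A = "generate \<Gamma> {\<sigma>\<^sub>1}" and ?B = "generate \<Gamma> {\<sigma>\<^sub>2}"
  note [simp] = sigma1(1) sigma2(1)
  have sub: "subgroup ?A \<Gamma>" "subgroup ?B \<Gamma>" by (auto intro: aut.generate_is_subgroup)
  have cA: "x \<in> carrier \<Gamma>" if "x \<in> ?A" for x using subgroup.mem_carrier[OF sub(1) that] .
  have cB: "x \<in> carrier \<Gamma>" if "x \<in> ?B" for x using subgroup.mem_carrier[OF sub(2) that] .
  have "card (carrier \<Gamma>) = card C" using bij_betw_aut_class by (rule bij_betw_same_card)
  then show ord: "order \<Gamma> = p * q" using card_class[OF fin] card by (simp add: order_def)
  have "finite C" using fin class_flags finite_subset by blast
  then have fin': "finite (carrier \<Gamma>)" using bij_betw_finite[OF bij_betw_aut_class] by simp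
  have "inj_on (\<lambda>(x, y). x \<otimes>\<^bsub>\<Gamma>\<^esub> y) (?A \<times> ?B)"
  proof (rule inj_onI, clarify)
    fix x y x' y' assume m: "x \<in> ?A" "y \<in> ?B" "x' \<in> ?A" "y' \<in> ?B" and eq: "x \<otimes>\<^bsub>\<Gamma>\<^esub> y = x' \<otimes>\<^bsub>\<Gamma>\<^esub> y'"
    note [simp] = cA[OF m(1)] cB[OF m(2)] cA[OF m(3)] cB[OF m(4)]
    have "inv\<^bsub>\<Gamma>\<^esub> x' \<otimes>\<^bsub>\<Gamma>\<^esub> (x \<otimes>\<^bsub>\<Gamma>\<^esub> y) \<otimes>\<^bsub>\<Gamma>\<^esub> inv\<^bsub>\<Gamma>\<^esub> y = inv\<^bsub>\<Gamma>\<^esub> x' \<otimes>\<^bsub>\<Gamma>\<^esub> (x' \<otimes>\<^bsub>\<Gamma>\<^esub> y') \<otimes>\<^bsub>\<Gamma>\<^esub> inv\<^bsub>\<Gamma>\<^esub> y"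
      by (simp add: eq)
    moreover have "inv\<^bsub>\<Gamma>\<^esub> x' \<otimes>\<^bsub>\<Gamma>\<^esub> (x \<otimes>\<^bsub>\<Gamma>\<^esub> y) \<otimes>\<^bsub>\<Gamma>\<^esub> inv\<^bsub>\<Gamma>\<^esub> y = inv\<^bsub>\<Gamma>\<^esub> x' \<otimes>\<^bsub>\<Gamma>\<^esub> x"
      by (simp add: aut.m_assoc)
    moreover have "inv\<^bsub>\<Gamma>\<^esub> x' \<otimes>\<^bsub>\<Gamma>\<^esub> (x' \<otimes>\<^bsub>\<Gamma>\<^esub> y') \<otimes>\<^bsub>\<Gamma>\<^esub> inv\<^bsub>\<Gamma>\<^esub> y = y' \<otimes>\<^bsub>\<Gamma>\<^esub> inv\<^bsub>\<Gamma>\<^esub> y"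
      by (simp flip: aut.m_assoc)
    ultimately have z: "inv\<^bsub>\<Gamma>\<^esub> x' \<otimes>\<^bsub>\<Gamma>\<^esub> x = y' \<otimes>\<^bsub>\<Gamma>\<^esub> inv\<^bsub>\<Gamma>\<^esub> y" by simp
    have "inv\<^bsub>\<Gamma>\<^esub> x' \<otimes>\<^bsub>\<Gamma>\<^esub> x \<in> ?A" using sub(1) m by (simp add: subgroup.m_closed subgroup.m_inv_closed)
    moreover have "inv\<^bsub>\<Gamma>\<^esub> x' \<otimes>\<^bsub>\<Gamma>\<^esub> x \<in> ?B"
      unfolding z using sub(2) m by (simp add: subgroup.m_closed subgroup.m_inv_closed)
    ultimately have "inv\<^bsub>\<Gamma>\<^esub> x' \<otimes>\<^bsub>\<Gamma>\<^esub> x = \<one>\<^bsub>\<Gamma>\<^esub>" by (rule generate_disjoint)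
    then have "x = x'" by (metis \<open>x \<in> carrier \<Gamma>\<close> \<open>x' \<in> carrier \<Gamma>\<close> aut.inv_closed aut.inv_equality aut.inv_inv)
    then show "x = x' \<and> y = y'" using eq by simp
  qed
  then have "card ((\<lambda>(x, y). x \<otimes>\<^bsub>\<Gamma>\<^esub> y) ` (?A \<times> ?B)) = card ?A * card ?B"
    by (simp add: card_image card_cartesian_product)
  also have "\<dots> = card (carrier \<Gamma>)"
    using ord aut.generate_pow_card[of \<sigma>\<^sub>1] aut.generate_pow_card[of \<sigma>\<^sub>2] ord_sigma1[OF type] ord_sigma2[OF type]
    by (simp add: order_def)
  finally have full: "(\<lambda>(x, y). x \<otimes>\<^bsub>\<Gamma>\<^esub> y) ` (?A \<times> ?B) = carrier \<Gamma>"
    using fin' cA cB by (intro card_subset_eq) auto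
  show "cyclic_factorization \<Gamma> \<sigma>\<^sub>1 \<sigma>\<^sub>2"
  proof
    show "finite (carrier \<Gamma>)" by (rule fin')
    show "\<sigma>\<^sub>1 \<otimes>\<^bsub>\<Gamma>\<^esub> \<sigma>\<^sub>2 \<otimes>\<^bsub>\<Gamma>\<^esub> (\<sigma>\<^sub>1 \<otimes>\<^bsub>\<Gamma>\<^esub> \<sigma>\<^sub>2) = \<one>\<^bsub>\<Gamma>\<^esub>" by (rule sigma_involution)
    show "odd (aut.ord \<sigma>\<^sub>2)" using ord_sigma2[OF type] \<open>odd q\<close> by simp
  next
    fix x assume "x \<in> carrier \<Gamma>"
    then have "x \<in> (\<lambda>(x, y). x \<otimes>\<^bsub>\<Gamma>\<^esub> y) ` (?A \<times> ?B)" by (simp only: full)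
    then obtain y z where yz: "y \<in> ?A" "z \<in> ?B" "x = y \<otimes>\<^bsub>\<Gamma>\<^esub> z" by (elim imageE SigmaE) simp
    obtain i j :: int where "y = \<sigma>\<^sub>1 [^]\<^bsub>\<Gamma>\<^esub> i" "z = \<sigma>\<^sub>2 [^]\<^bsub>\<Gamma>\<^esub> j"
      using yz(1,2) by (auto simp: aut.generate_pow)
    with yz(3) show "\<exists>(i::int) (j::int). x = \<sigma>\<^sub>1 [^]\<^bsub>\<Gamma>\<^esub> i \<otimes>\<^bsub>\<Gamma>\<^esub> \<sigma>\<^sub>2 [^]\<^bsub>\<Gamma>\<^esub> j" by blast
  next
    fix i j :: int assume eq: "\<sigma>\<^sub>1 [^]\<^bsub>\<Gamma>\<^esub> i = \<sigma>\<^sub>2 [^]\<^bsub>\<Gamma>\<^esub> j"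
    have "\<sigma>\<^sub>1 [^]\<^bsub>\<Gamma>\<^esub> i \<in> ?A" by (auto simp: aut.generate_pow)
    moreover have "\<sigma>\<^sub>1 [^]\<^bsub>\<Gamma>\<^esub> i \<in> ?B" unfolding eq by (auto simp: aut.generate_pow)
    ultimately show "\<sigma>\<^sub>1 [^]\<^bsub>\<Gamma>\<^esub> i = \<one>\<^bsub>\<Gamma>\<^esub>" by (rule generate_disjoint)
  qed auto
qed

text \<open>This transfers the core-freeness hypothesis to the automorphism group, where the results
  on factorizations apply.\<close>

lemma rotation_group_eq_aut:
  assumes "cyclic_factorization \<Gamma> \<sigma>\<^sub>1 \<sigma>\<^sub>2"
  shows "rotation_group P \<Phi> = \<Gamma>"
proof -
  have "carrier \<Gamma> \<subseteq> generate \<Gamma> {\<sigma>\<^sub>1, \<sigma>\<^sub>2}"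
  proof
    have H: "subgroup (generate \<Gamma> {\<sigma>\<^sub>1, \<sigma>\<^sub>2}) \<Gamma>"
      using sigma1(1) sigma2(1) by (intro aut.generate_is_subgroup) auto
    fix x assume "x \<in> carrier \<Gamma>"
    then obtain i j :: int where "x = \<sigma>\<^sub>1 [^]\<^bsub>\<Gamma>\<^esub> i \<otimes>\<^bsub>\<Gamma>\<^esub> \<sigma>\<^sub>2 [^]\<^bsub>\<Gamma>\<^esub> j"
      using cyclic_factorization.factorization[OF assms] by blast
    then show "x \<in> generate \<Gamma> {\<sigma>\<^sub>1, \<sigma>\<^sub>2}"
      using subgroup.m_closed[OF H] aut.subgroup_int_pow_closed[OF H]
      by (simp add: generate.incl)
  qed
  moreover have "generate \<Gamma> {\<sigma>\<^sub>1, \<sigma>\<^sub>2} \<subseteq> carrier \<Gamma>"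
    using sigma1(1) sigma2(1) by (intro aut.generate_incl) auto
  ultimately have "generate \<Gamma> (carrier \<Gamma> \<inter> {\<sigma>\<^sub>1, \<sigma>\<^sub>2}) = carrier \<Gamma>"
    using sigma1(1) sigma2(1) by (simp add: Int_absorb1)
  then show ?thesis
    by (simp add: rotation_group_def subgroup_generated_def)
qed

end

theorem theorem5p1:
  fixes P :: "'a ranked_poset" and \<Phi> :: "'a flag" and p q :: nat
  assumes "polyhedron P"
    and "chiral P"
    and "has_type P p q"
    and "tight P p q"
    and "odd q"
    and "\<Phi> \<in> flags P"
  shows "(even p \<and> p dvd 2 * q) \<and>
    (core_free (rotation_group P \<Phi>) (generate (rotation_group P \<Phi>) {sigma2 P \<Phi>}) \<longrightarrow> p = 2 * q)"
proof -
  interpret polyhedron P by fact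
  obtain C where C: "\<Phi> \<in> C" "C \<subseteq> flags P"
    "\<And>\<Psi> i. \<Psi> \<in> flags P \<Longrightarrow> i \<le> 2 \<Longrightarrow> adj_flag P i \<Psi> \<in> C \<longleftrightarrow> \<Psi> \<notin> C"
    "transitive_on_flags P C"
    "\<And>h \<Psi>. h \<in> carrier (aut_group P) \<Longrightarrow> \<Psi> \<in> C \<Longrightarrow> flag_map h \<Psi> \<in> C"
    using chiral_classE[OF assms(2,6)] by metis
  interpret chiral_class P C \<Phi> by unfold_locales (use C in auto)
  note cyclic = cyclic_factorization_aut[OF assms(4,5)]
  interpret cyclic_factorization "aut_group P" "sigma1 P \<Phi>" "sigma2 P \<Phi>"
    by (rule cyclic(1))
  note ords = ord_sigma1[OF assms(3)] ord_sigma2[OF assms(3)]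
  have even: "even p" using even_ord sigma_involution(2) cyclic(2) by (simp add: ords)
  \<comment> \<open>The identity has order \<open>1\<close>, which is odd.\<close>
  then have "sigma1 P \<Phi> \<noteq> \<one>\<^bsub>aut_group P\<^esub>" using ords(1) by auto
  with even show ?thesis
    using ord_dvd_twice ord_eq_twice_if_core_free
    by (simp add: ords rotation_group_eq_aut[OF cyclic(1)])
qed

end
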